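(* Let $p\in[1,\infty]$ and let $L(X)$ be the free locally convex space over a Tychonoff space $X$. Then (i) every bounded subset of $L(X)$ is coarse $p$-limited; (ii) $L(X)$ has the coarse $GP_p$ property if and only if every functionally bounded subset of $X$ is finite.
   Context: The free locally convex space over a Tychonoff space $X$ is a locally convex space $L(X)$ with a continuous map $i:X\to L(X)$ such that every continuous map $f$ from $X$ to a locally convex space $E$ extends uniquely to a continuous linear operator $\bar f:L(X)\to E$ with $f=\bar f\circ i$. A subset of $X$ is functionally bounded if every continuous real function on $X$ is bounded on it. A subset $A$ of an lcs $E$ is coarse $p$-limited if $T(A)$ is relatively compact for every continuous linear $T:E\to\ell_p$ ($T:E\to c_0$ if $p=\infty$). $E$ has the coarse $GP_p$ property if every coarse $p$-limited subset of $E$ is relatively compact. *)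

theory Defs
  imports "HOL-Analysis.Analysis"
begin

text \<open>Underlying vector space: finitely supported real functions on topspace X
  (formal finite linear combinations of points of X); the canonical map is the Dirac map.\<close>

definition Lcarrier :: "'a topology \<Rightarrow> ('a \<Rightarrow> real) set" where
  "Lcarrier X = {u. finite {x. u x \<noteq> 0} \<and> {x. u x \<noteq> 0} \<subseteq> topspace X}"

definition dirac :: "'a \<Rightarrow> 'a \<Rightarrow> real" where
  "dirac x = (\<lambda>y. if y = x then 1 else 0)"

definition seminorm_on :: "('b \<Rightarrow> real) set \<Rightarrow> (('b \<Rightarrow> real) \<Rightarrow> real) \<Rightarrow> bool" where
  "seminorm_on S q \<longleftrightarrow>
     (\<forall>u\<in>S. 0 \<le> q u) \<and>
     (\<forall>u\<in>S. \<forall>v\<in>S. q (\<lambda>x. u x + v x) \<le> q u + q v) \<and>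
     (\<forall>u\<in>S. \<forall>c. q (\<lambda>x. c * u x) = \<bar>c\<bar> * q u)"

definition admissible_seminorm :: "'a topology \<Rightarrow> (('a \<Rightarrow> real) \<Rightarrow> real) \<Rightarrow> bool" where
  "admissible_seminorm X q \<longleftrightarrow> seminorm_on (Lcarrier X) q \<and>
     (\<forall>x\<in>topspace X. \<forall>\<epsilon>>0. \<exists>U. openin X U \<and> x \<in> U \<and>
         (\<forall>y\<in>U. q (\<lambda>z. dirac y z - dirac x z) < \<epsilon>))"

text \<open>The free locally convex topology: the finest locally convex topology on L(X)
  making i continuous, i.e. the one generated by all admissible seminorms
  (this family is directed, so single seminorm balls form a neighbourhood base).\<close>
definition free_lc_topology :: "'a topology \<Rightarrow> ('a \<Rightarrow> real) topology" where
  "free_lc_topology X = topology (\<lambda>V. V \<subseteq> Lcarrier X \<and>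
     (\<forall>u\<in>V. \<exists>q \<epsilon>. admissible_seminorm X q \<and> \<epsilon> > 0 \<and>
        {v \<in> Lcarrier X. q (\<lambda>x. v x - u x) < \<epsilon>} \<subseteq> V))"

definition lp_space :: "ereal \<Rightarrow> (nat \<Rightarrow> real) set" where
  "lp_space p = (if p = \<infinity> then {a. a \<longlonglongrightarrow> 0}
                 else {a. summable (\<lambda>n. \<bar>a n\<bar> powr real_of_ereal p)})"

definition lp_norm :: "ereal \<Rightarrow> (nat \<Rightarrow> real) \<Rightarrow> real" where
  "lp_norm p a = (if p = \<infinity> then (SUP n. \<bar>a n\<bar>)
                  else (\<Sum>n. \<bar>a n\<bar> powr real_of_ereal p) powr (1 / real_of_ereal p))"

definition lp_topology :: "ereal \<Rightarrow> (nat \<Rightarrow> real) topology" where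
  "lp_topology p = topology (\<lambda>V. V \<subseteq> lp_space p \<and>
     (\<forall>a\<in>V. \<exists>\<epsilon>>0. {b \<in> lp_space p. lp_norm p (\<lambda>n. b n - a n) < \<epsilon>} \<subseteq> V))"

definition relatively_compact_in :: "'b topology \<Rightarrow> 'b set \<Rightarrow> bool" where
  "relatively_compact_in T A \<longleftrightarrow> compactin T (T closure_of A)"

definition linear_on :: "('b \<Rightarrow> real) set \<Rightarrow> (('b \<Rightarrow> real) \<Rightarrow> (nat \<Rightarrow> real)) \<Rightarrow> bool" where
  "linear_on S T \<longleftrightarrow>
     (\<forall>u\<in>S. \<forall>v\<in>S. T (\<lambda>x. u x + v x) = (\<lambda>n. T u n + T v n)) \<and>
     (\<forall>u\<in>S. \<forall>c. T (\<lambda>x. c * u x) = (\<lambda>n. c * T u n))"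

definition lc_bounded :: "'a topology \<Rightarrow> ('a \<Rightarrow> real) set \<Rightarrow> bool" where
  "lc_bounded X A \<longleftrightarrow> A \<subseteq> Lcarrier X \<and>
     (\<forall>U. openin (free_lc_topology X) U \<and> (\<lambda>x. 0) \<in> U \<longrightarrow>
        (\<exists>t>0. (\<lambda>u x. t * u x) ` A \<subseteq> U))"

definition coarse_p_limited :: "ereal \<Rightarrow> 'a topology \<Rightarrow> ('a \<Rightarrow> real) set \<Rightarrow> bool" where
  "coarse_p_limited p X A \<longleftrightarrow> A \<subseteq> Lcarrier X \<and>
     (\<forall>T. linear_on (Lcarrier X) T \<and> continuous_map (free_lc_topology X) (lp_topology p) T
          \<longrightarrow> relatively_compact_in (lp_topology p) (T ` A))"

definition coarse_GP :: "ereal \<Rightarrow> 'a topology \<Rightarrow> bool" where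
  "coarse_GP p X \<longleftrightarrow>
     (\<forall>A. coarse_p_limited p X A \<longrightarrow> relatively_compact_in (free_lc_topology X) A)"

definition functionally_bounded :: "'a topology \<Rightarrow> 'a set \<Rightarrow> bool" where
  "functionally_bounded X A \<longleftrightarrow> A \<subseteq> topspace X \<and>
     (\<forall>f. continuous_map X euclideanreal f \<longrightarrow> bounded (f ` A))"

end

theory Submission
  imports Defs
begin

text \<open>Pairing \<open>L(X)\<close> with the continuous functions on \<open>X\<close>, a gliding hump shows that the supports of a
  weakly bounded set \<open>A\<close> lie in one functionally bounded set \<open>S\<close>, and the uniform boundedness principle
  bounds the \<open>\<ell>\<^sub>1\<close>-norms of the coefficients. A functionally bounded set is totally bounded for
  every continuous pseudometric \<open>q (x - y)\<close>, hence \<open>A\<close> is totally bounded for every continuous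
  seminorm \<open>q\<close>. Taking \<open>q = \<parallel>T \<cdot>\<parallel>\<close> and using completeness of \<open>\<ell>\<^sub>p\<close> gives (i).
  If functionally bounded sets are finite, \<open>A\<close> lies in a compact finite-dimensional box. Conversely, for
  distinct points \<open>x\<^sub>n\<close> of a functionally bounded set the partial sums of \<open>\<Sum>n. 2\<^sup>-\<^sup>n x\<^sub>n\<close> are bounded, but
  an accumulation point would have infinite support.\<close>

section \<open>The sequence spaces\<close>

text \<open>Weak boundedness is the common ground: bounded sets have it because each
  \<open>\<bar>pairing u f\<bar>\<close> is an admissible seminorm, and it turns out to be
  equivalent to coarse p-limitedness, so the coarse p-limited sets are the same for all p. The
  exponent enters only through the completeness of the target and one nonzero test sequence in it.
  Two bounds, on supports and on coefficients, are proved by different means because continuous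
  functions on X may be unbounded: the sup norm is at hand only for bounded functions, which norm
  the coefficients but say nothing about where the supports lie, and these are confined by locally
  finite sums of growing height. Total boundedness for every admissible seminorm is weaker than
  relative compactness since L(X) may fail to be complete. This gap separates (i) from (ii): the
  partial sums built from an infinite functionally bounded set are totally bounded, hence coarse
  p-limited, without having compact closure.\<close>

lemma powr_convex_combination:
  fixes x y t r :: real
  assumes "0 \<le> x" "0 \<le> y" "0 \<le> t" "t \<le> 1" "1 \<le> r"
  shows "(t * x + (1 - t) * y) powr r \<le> t * x powr r + (1 - t) * y powr r"
proof -
  \<comment> \<open>When one argument is zero, the claim reduces to \<open>s powr r \<le> s\<close>
    for s between 0 and 1; convexity is invoked at positive arguments.\<close>
  have small: "(s * z) powr r \<le> s * z powr r" if "0 \<le> z" "0 \<le> s" "s \<le> 1" for s z :: real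
  proof -
    have "s powr r \<le> s"
      using that assms powr_mono'[of 1 r s] by (cases "s = 0") auto
    then show ?thesis
      using that by (simp add: powr_mult mult_right_mono)
  qed
  consider "x = 0" | "y = 0" | "0 < x" "0 < y" using assms by linarith
  then show ?thesis
  proof cases
    case 1 then show ?thesis using small[of y "1 - t"] assms by simp
  next
    case 2 then show ?thesis using small[of x t] assms by simp
  next
    case 3
    then show ?thesis
      using convex_onD[OF powr_convex[OF \<open>1 \<le> r\<close>], of t y x] assms
      by (simp add: algebra_simps)
  qed
qed

text \<open>After division by \<open>A + B\<close>, \<open>\<bar>a n\<bar> + \<bar>b n\<bar>\<close>
  is a convex combination of \<open>\<bar>a n\<bar> / A\<close> and
  \<open>\<bar>b n\<bar> / B\<close> with weight \<open>t = A / (A + B)\<close>. Convexity of the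
  power, summed over n, gives the bound. Positive upper bounds replace the norms so that the
  divisions make sense.\<close>

lemma Minkowski_powr:
  fixes a b :: "nat \<Rightarrow> real"
  assumes r: "1 \<le> r" and AB: "0 < A" "0 < B"
    and a: "summable (\<lambda>n. \<bar>a n\<bar> powr r)" "(\<Sum>n. \<bar>a n\<bar> powr r) \<le> A powr r"
    and b: "summable (\<lambda>n. \<bar>b n\<bar> powr r)" "(\<Sum>n. \<bar>b n\<bar> powr r) \<le> B powr r"
  shows "summable (\<lambda>n. \<bar>a n + b n\<bar> powr r)"
    and "(\<Sum>n. \<bar>a n + b n\<bar> powr r) \<le> (A + B) powr r"
proof -
  define t where "t = A / (A + B)"
  have t: "0 \<le> t" "t \<le> 1" "1 - t = B / (A + B)"
    using AB by (auto simp: t_def field_simps)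
  define F where "F n = (A + B) powr r *
    (t * (\<bar>a n\<bar> powr r / A powr r) + (1 - t) * (\<bar>b n\<bar> powr r / B powr r))" for n
  have le: "\<bar>a n + b n\<bar> powr r \<le> F n" for n
  proof -
    have "\<bar>a n + b n\<bar> powr r \<le> (\<bar>a n\<bar> + \<bar>b n\<bar>) powr r"
      using r by (intro powr_mono2) auto
    also have "\<bar>a n\<bar> + \<bar>b n\<bar> = (A + B) * (t * (\<bar>a n\<bar> / A) + (1 - t) * (\<bar>b n\<bar> / B))"
    proof -
      have AB': "(A + B) * t = A" "(A + B) * (1 - t) = B"
        using AB unfolding t(3) by (simp_all add: t_def)
      have "(A + B) * (t * (\<bar>a n\<bar> / A) + (1 - t) * (\<bar>b n\<bar> / B))
          = ((A + B) * t) * (\<bar>a n\<bar> / A) + ((A + B) * (1 - t)) * (\<bar>b n\<bar> / B)"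
        by (simp only: distrib_left mult.assoc)
      then show ?thesis using AB unfolding AB' by simp
    qed
    also have "\<dots> powr r = (A + B) powr r * (t * (\<bar>a n\<bar> / A) + (1 - t) * (\<bar>b n\<bar> / B)) powr r"
      by (rule powr_mult)
    also have "\<dots> \<le> (A + B) powr r * (t * (\<bar>a n\<bar> / A) powr r + (1 - t) * (\<bar>b n\<bar> / B) powr r)"
      using powr_convex_combination[of "\<bar>a n\<bar> / A" "\<bar>b n\<bar> / B" t r] AB t r
      by (intro mult_left_mono) auto
    also have "\<dots> = F n"
      using AB by (simp add: F_def powr_divide)
    finally show ?thesis .
  qed
  have sF: "F sums ((A + B) powr r * (t * ((\<Sum>n. \<bar>a n\<bar> powr r) / A powr r)
      + (1 - t) * ((\<Sum>n. \<bar>b n\<bar> powr r) / B powr r)))"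
    unfolding F_def
    by (intro sums_mult sums_add sums_divide summable_sums a b)
  show summ: "summable (\<lambda>n. \<bar>a n + b n\<bar> powr r)"
    by (rule summable_comparison_test'[OF sums_summable[OF sF], of 0]) (use le in auto)
  have "(\<Sum>n. \<bar>a n + b n\<bar> powr r) \<le> suminf F"
    by (intro suminf_le le summ sums_summable[OF sF])
  also have "\<dots> = (A + B) powr r * (t * ((\<Sum>n. \<bar>a n\<bar> powr r) / A powr r)
      + (1 - t) * ((\<Sum>n. \<bar>b n\<bar> powr r) / B powr r))"
    using sF by (simp add: sums_iff)
  also have "\<dots> \<le> (A + B) powr r * (t * 1 + (1 - t) * 1)"
    using a b t AB by (intro mult_left_mono add_mono) (auto simp: divide_simps)
  finally show "(\<Sum>n. \<bar>a n + b n\<bar> powr r) \<le> (A + B) powr r" by simp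
qed

section \<open>Vector space structure and norm of the sequence spaces\<close>

lemma lp_exponent_cases:
  assumes "1 \<le> p"
  obtains "p = \<infinity>" | r where "p = ereal r" "1 \<le> r"
  using assms by (cases p) auto

lemma c0_bdd_above:
  fixes a :: "nat \<Rightarrow> real"
  assumes "a \<longlonglongrightarrow> 0"
  shows "bdd_above (range (\<lambda>n. \<bar>a n\<bar>))"
  using convergent_imp_bounded[OF assms]
  by (auto simp: bounded_iff bdd_above_def)

lemma abs_le_lp_norm:
  assumes "1 \<le> p" "a \<in> lp_space p"
  shows "\<bar>a n\<bar> \<le> lp_norm p a"
  using assms(1)
proof (cases rule: lp_exponent_cases)
  case 1
  then show ?thesis
    using assms c0_bdd_above[of a] by (auto simp: lp_space_def lp_norm_def intro!: cSUP_upper)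
next
  case (2 r)
  have s: "summable (\<lambda>n. \<bar>a n\<bar> powr r)" using assms 2 by (simp add: lp_space_def)
  have "\<bar>a n\<bar> powr r \<le> (\<Sum>n. \<bar>a n\<bar> powr r)"
    using sum_le_suminf[OF s, of "{n}"] by simp
  then have "(\<bar>a n\<bar> powr r) powr (1 / r) \<le> (\<Sum>n. \<bar>a n\<bar> powr r) powr (1 / r)"
    using 2 by (intro powr_mono2) auto
  then show ?thesis
    using 2 by (simp add: lp_norm_def powr_powr)
qed

lemma lp_norm_nonneg: "1 \<le> p \<Longrightarrow> a \<in> lp_space p \<Longrightarrow> 0 \<le> lp_norm p a"
  using abs_le_lp_norm[of p a 0] by linarith

text \<open>Packs membership and norm bound into one condition on finite partial sums, a form that
  survives scaling and coordinatewise limits.\<close>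

lemma lp_norm_ereal_le_iff:
  assumes "1 \<le> r" "0 \<le> C"
  shows "a \<in> lp_space (ereal r) \<and> lp_norm (ereal r) a \<le> C
    \<longleftrightarrow> (\<forall>M. (\<Sum>n<M. \<bar>a n\<bar> powr r) \<le> C powr r)"
proof safe
  fix M
  assume a: "a \<in> lp_space (ereal r)" and le: "lp_norm (ereal r) a \<le> C"
  have s: "summable (\<lambda>n. \<bar>a n\<bar> powr r)" using a by (simp add: lp_space_def)
  have "0 \<le> (\<Sum>n. \<bar>a n\<bar> powr r)" using s by (simp add: suminf_nonneg)
  then have "(\<Sum>n. \<bar>a n\<bar> powr r) = lp_norm (ereal r) a powr r"
    using assms by (simp add: lp_norm_def powr_powr)
  also have "\<dots> \<le> C powr r"
    using assms le lp_norm_nonneg[OF _ a] by (intro powr_mono2) auto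
  finally show "(\<Sum>n<M. \<bar>a n\<bar> powr r) \<le> C powr r"
    using sum_le_suminf[OF s, of "{..<M}"] by simp
next
  assume H: "\<forall>M. (\<Sum>n<M. \<bar>a n\<bar> powr r) \<le> C powr r"
  have s: "summable (\<lambda>n. \<bar>a n\<bar> powr r)"
    by (rule summableI_nonneg_bounded) (use H in auto)
  then show "a \<in> lp_space (ereal r)" by (simp add: lp_space_def)
  have "(\<Sum>n. \<bar>a n\<bar> powr r) \<le> C powr r"
    by (rule suminf_le_const[OF s]) (use H in auto)
  then have "lp_norm (ereal r) a \<le> (C powr r) powr (1 / r)"
    using assms s by (auto simp: lp_norm_def intro!: powr_mono2 suminf_nonneg)
  then show "lp_norm (ereal r) a \<le> C" using assms by (simp add: powr_powr)
qed

lemma lp_add: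
  assumes p: "1 \<le> p" and a: "a \<in> lp_space p" and b: "b \<in> lp_space p"
  shows "(\<lambda>n. a n + b n) \<in> lp_space p"
    and "lp_norm p (\<lambda>n. a n + b n) \<le> lp_norm p a + lp_norm p b"
proof -
  have "(\<lambda>n. a n + b n) \<in> lp_space p
      \<and> lp_norm p (\<lambda>n. a n + b n) \<le> lp_norm p a + lp_norm p b"
    using p
  proof (cases rule: lp_exponent_cases)
    case 1
    have "(\<lambda>n. a n + b n) \<longlonglongrightarrow> 0"
      using a b 1 tendsto_add[of a 0 sequentially b 0] by (simp add: lp_space_def)
    moreover have "\<bar>a n + b n\<bar> \<le> lp_norm p a + lp_norm p b" for n
      using abs_le_lp_norm[OF p a, of n] abs_le_lp_norm[OF p b, of n] by linarith
    ultimately show ?thesis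
      using 1 by (auto simp: lp_space_def lp_norm_def intro!: cSUP_least)
  next
    case (2 r)
    \<comment> \<open>\<open>Minkowski_powr\<close> wants positive bounds but the norms may vanish,
      so each is raised by \<open>e / 2\<close> and e is arbitrary at the end.\<close>
    have step: "(\<lambda>n. a n + b n) \<in> lp_space p
        \<and> lp_norm p (\<lambda>n. a n + b n) \<le> lp_norm p a + lp_norm p b + e" if "0 < e" for e
    proof -
      define A B where "A = lp_norm p a + e / 2" and "B = lp_norm p b + e / 2"
      have AB: "0 < A" "0 < B"
        using lp_norm_nonneg[OF p a] lp_norm_nonneg[OF p b] that by (auto simp: A_def B_def)
      have bound: "summable (\<lambda>n. \<bar>c n\<bar> powr r) \<and> (\<Sum>n. \<bar>c n\<bar> powr r) \<le> C powr r"
        if c: "c \<in> lp_space p" "lp_norm p c \<le> C" "0 < C" for c C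
      proof
        show s: "summable (\<lambda>n. \<bar>c n\<bar> powr r)" using c 2 by (simp add: lp_space_def)
        show "(\<Sum>n. \<bar>c n\<bar> powr r) \<le> C powr r"
          using lp_norm_ereal_le_iff[of r C c] 2 c by (intro suminf_le_const[OF s]) auto
      qed
      have "summable (\<lambda>n. \<bar>a n + b n\<bar> powr r)"
        "(\<Sum>n. \<bar>a n + b n\<bar> powr r) \<le> (A + B) powr r"
        using Minkowski_powr[OF \<open>1 \<le> r\<close> AB] bound[OF a, of A] bound[OF b, of B] AB that
        by (auto simp: A_def B_def)
      then have "\<forall>M. (\<Sum>n<M. \<bar>a n + b n\<bar> powr r) \<le> (A + B) powr r"
        by (meson order_trans sum_le_suminf finite_lessThan powr_ge_zero)
      then show ?thesis
        using lp_norm_ereal_le_iff[of r "A + B" "\<lambda>n. a n + b n"] 2 AB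
        by (simp add: A_def B_def)
    qed
    show ?thesis
      using step[of 1] step by (auto intro: field_le_epsilon)
  qed
  then show "(\<lambda>n. a n + b n) \<in> lp_space p"
    "lp_norm p (\<lambda>n. a n + b n) \<le> lp_norm p a + lp_norm p b" by auto
qed

lemma lp_scale_le:
  assumes p: "1 \<le> p" and a: "a \<in> lp_space p"
  shows "(\<lambda>n. c * a n) \<in> lp_space p \<and> lp_norm p (\<lambda>n. c * a n) \<le> \<bar>c\<bar> * lp_norm p a"
  using p
proof (cases rule: lp_exponent_cases)
  case 1
  have "(\<lambda>n. c * a n) \<longlonglongrightarrow> 0"
    using a 1 by (simp add: lp_space_def tendsto_mult_right_zero)
  then show ?thesis
    using 1 abs_le_lp_norm[OF p a]
    by (auto simp: lp_space_def lp_norm_def abs_mult intro!: cSUP_least mult_left_mono)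
next
  case (2 r)
  have "(\<Sum>n<M. \<bar>c * a n\<bar> powr r) \<le> (\<bar>c\<bar> * lp_norm p a) powr r" for M
  proof -
    have "(\<Sum>n<M. \<bar>c * a n\<bar> powr r) = \<bar>c\<bar> powr r * (\<Sum>n<M. \<bar>a n\<bar> powr r)"
      by (simp add: abs_mult powr_mult sum_distrib_left)
    also have "\<dots> \<le> \<bar>c\<bar> powr r * lp_norm p a powr r"
      using lp_norm_ereal_le_iff[of r "lp_norm p a" a] 2 a lp_norm_nonneg[OF p a]
      by (intro mult_left_mono) auto
    finally show ?thesis
      using lp_norm_nonneg[OF p a] by (simp add: powr_mult)
  qed
  then show ?thesis
    using lp_norm_ereal_le_iff[of r "\<bar>c\<bar> * lp_norm p a" "\<lambda>n. c * a n"] 2 lp_norm_nonneg[OF p a]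
    by simp
qed

text \<open>The upper bound, applied a second time with the scalar \<open>inverse c\<close>, turns
  into the missing lower bound.\<close>

lemma lp_scale:
  assumes p: "1 \<le> p" and a: "a \<in> lp_space p"
  shows "(\<lambda>n. c * a n) \<in> lp_space p"
    and "lp_norm p (\<lambda>n. c * a n) = \<bar>c\<bar> * lp_norm p a"
proof -
  show 1: "(\<lambda>n. c * a n) \<in> lp_space p" using lp_scale_le[OF assms] by blast
  have le: "lp_norm p (\<lambda>n. c * a n) \<le> \<bar>c\<bar> * lp_norm p a" using lp_scale_le[OF assms] by blast
  have "\<bar>c\<bar> * lp_norm p a \<le> lp_norm p (\<lambda>n. c * a n)"
  proof (cases "c = 0")
    case True
    then show ?thesis using lp_norm_nonneg[OF p 1] by simp
  next
    case False
    have "lp_norm p (\<lambda>n. inverse c * (c * a n)) \<le> \<bar>inverse c\<bar> * lp_norm p (\<lambda>n. c * a n)"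
      using lp_scale_le[OF p 1] by blast
    then show ?thesis using False by (simp add: field_simps)
  qed
  with le show "lp_norm p (\<lambda>n. c * a n) = \<bar>c\<bar> * lp_norm p a" by simp
qed

lemma lp_diff:
  assumes "1 \<le> p" "a \<in> lp_space p" "b \<in> lp_space p"
  shows "(\<lambda>n. a n - b n) \<in> lp_space p"
  using lp_add(1)[OF assms(1,2) lp_scale(1)[OF assms(1,3), of "-1"]] by simp

lemma lp_norm_diff_commute:
  assumes "1 \<le> p" "a \<in> lp_space p" "b \<in> lp_space p"
  shows "lp_norm p (\<lambda>n. a n - b n) = lp_norm p (\<lambda>n. b n - a n)"
  using lp_scale(2)[OF assms(1) lp_diff[OF assms], of "-1"] by simp

lemma lp_norm_diff_triangle:
  assumes "1 \<le> p" "a \<in> lp_space p" "b \<in> lp_space p" "c \<in> lp_space p"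
  shows "lp_norm p (\<lambda>n. a n - c n)
    \<le> lp_norm p (\<lambda>n. a n - b n) + lp_norm p (\<lambda>n. b n - c n)"
  using lp_add(2)[OF assms(1) lp_diff[OF assms(1,2,3)] lp_diff[OF assms(1,3,4)]] by simp

text \<open>The locale asks for symmetry and nonnegativity on the whole type, hence the default
  value 0 off the space.\<close>

lemma Metric_space_lp:
  assumes p: "1 \<le> p"
  shows "Metric_space (lp_space p) (\<lambda>a b. if a \<in> lp_space p \<and> b \<in> lp_space p
      then lp_norm p (\<lambda>n. a n - b n) else 0)"
proof
  fix a b c assume a: "a \<in> lp_space p" and b: "b \<in> lp_space p"
  have "a = b" if "lp_norm p (\<lambda>n. a n - b n) = 0"
    using abs_le_lp_norm[OF p lp_diff[OF p a b]] that by fastforce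
  moreover have "lp_norm p (\<lambda>n. a n - a n) = 0"
    using lp_scale(2)[OF p a, of 0] by simp
  ultimately show "((if a \<in> lp_space p \<and> b \<in> lp_space p
      then lp_norm p (\<lambda>n. a n - b n) else 0) = 0) = (a = b)"
    using a b by auto
  assume c: "c \<in> lp_space p"
  show "(if a \<in> lp_space p \<and> c \<in> lp_space p then lp_norm p (\<lambda>n. a n - c n) else 0)
    \<le> (if a \<in> lp_space p \<and> b \<in> lp_space p then lp_norm p (\<lambda>n. a n - b n) else 0)
      + (if b \<in> lp_space p \<and> c \<in> lp_space p then lp_norm p (\<lambda>n. b n - c n) else 0)"
    using lp_norm_diff_triangle[OF p a b c] a b c by simp
qed (use lp_norm_diff_commute[OF p] in \<open>auto simp: lp_norm_nonneg lp_diff p\<close>)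

text \<open>Completeness with the coordinatewise limit already given. A bound on
  \<open>s k - s l\<close> passes to \<open>s k - a\<close> as l grows: through each partial sum for
  a finite exponent, through each coordinate for c0.\<close>

lemma lp_limit:
  assumes p: "1 \<le> p" and s: "\<And>k. s k \<in> lp_space p"
    and lim: "\<And>n. (\<lambda>k. s k n) \<longlonglongrightarrow> a n"
    and Cauchy: "\<And>e. 0 < e \<Longrightarrow> \<exists>N. \<forall>k\<ge>N. \<forall>l\<ge>N. lp_norm p (\<lambda>n. s k n - s l n) < e"
  shows "a \<in> lp_space p" and "0 < e \<Longrightarrow> \<exists>N. \<forall>k\<ge>N. lp_norm p (\<lambda>n. s k n - a n) \<le> e"
proof -
  have diff: "\<exists>N. \<forall>k\<ge>N. (\<lambda>n. s k n - a n) \<in> lp_space p \<and> lp_norm p (\<lambda>n. s k n - a n) \<le> e"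
    if e: "0 < e" for e
  proof -
    obtain N where N: "\<And>k l. N \<le> k \<Longrightarrow> N \<le> l \<Longrightarrow> lp_norm p (\<lambda>n. s k n - s l n) < e"
      using Cauchy[OF e] by blast
    have d: "(\<lambda>n. s k n - s l n) \<in> lp_space p" for k l using lp_diff[OF p s s] .
    have "(\<lambda>n. s k n - a n) \<in> lp_space p \<and> lp_norm p (\<lambda>n. s k n - a n) \<le> e" if k: "N \<le> k" for k
      using p
    proof (cases rule: lp_exponent_cases)
      case 1
      have bound: "\<bar>s k n - a n\<bar> \<le> e'" if "0 < e'"
        "\<forall>k'\<ge>N'. \<forall>l\<ge>N'. lp_norm p (\<lambda>n. s k' n - s l n) < e'" "N' \<le> k" for e' N' k n
      proof (rule tendsto_upperbound)
        show "(\<lambda>l. \<bar>s k n - s l n\<bar>) \<longlonglongrightarrow> \<bar>s k n - a n\<bar>"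
          by (intro tendsto_intros lim)
        show "\<forall>\<^sub>F l in sequentially. \<bar>s k n - s l n\<bar> \<le> e'"
        proof (rule eventually_sequentiallyI[of N'])
          fix l assume "N' \<le> l"
          then have "lp_norm p (\<lambda>n. s k n - s l n) < e'" using that by blast
          then show "\<bar>s k n - s l n\<bar> \<le> e'"
            using abs_le_lp_norm[OF p d[of k l], of n] by linarith
        qed
      qed simp
      \<comment> \<open>A uniform limit of null sequences is null: \<open>s M - a\<close> is at most
        \<open>e' / 3\<close> in every coordinate, and \<open>s k - s M\<close> is eventually that
        small.\<close>
      have "(\<lambda>n. s k n - a n) \<longlonglongrightarrow> 0" for k
      proof (rule LIMSEQ_I)
        fix e' :: real assume e': "0 < e'"
        obtain M where M: "\<forall>k\<ge>M. \<forall>l\<ge>M. lp_norm p (\<lambda>n. s k n - s l n) < e' / 3"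
          using Cauchy[of "e' / 3"] e' by auto
        have "(\<lambda>n. s k n - s M n) \<longlonglongrightarrow> 0"
          using d[of k M] 1 by (simp add: lp_space_def)
        then obtain n0 where n0: "\<And>n. n \<ge> n0 \<Longrightarrow> \<bar>s k n - s M n\<bar> < e' / 3"
          using LIMSEQ_D[of "\<lambda>n. s k n - s M n" 0 "e' / 3"] e' by auto
        show "\<exists>no. \<forall>n\<ge>no. norm (s k n - a n - 0) < e'"
        proof (intro exI allI impI)
          fix n assume "n0 \<le> n"
          then show "norm (s k n - a n - 0) < e'"
            using n0[of n] bound[OF _ M order_refl, of n] e' unfolding real_norm_def by linarith
        qed
      qed
      moreover have "\<bar>s k n - a n\<bar> \<le> e" for n
        using bound[of e N k n] N k e by blast
      ultimately show ?thesis
        using 1 by (auto simp: lp_space_def lp_norm_def intro!: cSUP_least)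
    next
      case (2 r)
      have "(\<Sum>n<M. \<bar>s k n - a n\<bar> powr r) \<le> e powr r" for M
      proof (rule tendsto_upperbound)
        show "(\<lambda>l. \<Sum>n<M. \<bar>s k n - s l n\<bar> powr r) \<longlonglongrightarrow> (\<Sum>n<M. \<bar>s k n - a n\<bar> powr r)"
          using 2 by (intro tendsto_sum tendsto_powr' tendsto_intros lim) auto
        show "\<forall>\<^sub>F l in sequentially. (\<Sum>n<M. \<bar>s k n - s l n\<bar> powr r) \<le> e powr r"
        proof (rule eventually_sequentiallyI[of N])
          fix l assume "N \<le> l"
          then show "(\<Sum>n<M. \<bar>s k n - s l n\<bar> powr r) \<le> e powr r"
            using lp_norm_ereal_le_iff[of r e "\<lambda>n. s k n - s l n"] 2 e d[of k l] N[OF k, of l] by auto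
        qed
      qed simp
      then show ?thesis
        using lp_norm_ereal_le_iff[of r e "\<lambda>n. s k n - a n"] 2 e by simp
    qed
    then show ?thesis by blast
  qed
  obtain N where "(\<lambda>n. s N n - a n) \<in> lp_space p" using diff[of 1] by auto
  from lp_diff[OF p s[of N] this] show "a \<in> lp_space p" by simp
  show "0 < e \<Longrightarrow> \<exists>N. \<forall>k\<ge>N. lp_norm p (\<lambda>n. s k n - a n) \<le> e" using diff by blast
qed

section \<open>The norm topology and its relatively compact sets\<close>

lemma lp_topology_eq_mtopology:
  assumes p: "1 \<le> p"
  shows "lp_topology p = Metric_space.mtopology (lp_space p)
    (\<lambda>a b. if a \<in> lp_space p \<and> b \<in> lp_space p then lp_norm p (\<lambda>n. a n - b n) else 0)"
proof -
  interpret Metric_space "lp_space p"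
    "\<lambda>a b. if a \<in> lp_space p \<and> b \<in> lp_space p then lp_norm p (\<lambda>n. a n - b n) else 0"
    by (rule Metric_space_lp[OF p])
  have ball: "mball a e = {b \<in> lp_space p. lp_norm p (\<lambda>n. b n - a n) < e}"
    if "a \<in> lp_space p" for a e
    using that lp_norm_diff_commute[OF p, of a] by (auto simp: mball_def)
  have "(V \<subseteq> lp_space p \<and>
     (\<forall>a\<in>V. \<exists>\<epsilon>>0. {b \<in> lp_space p. lp_norm p (\<lambda>n. b n - a n) < \<epsilon>} \<subseteq> V))
     = mopen V" for V
  proof (cases "V \<subseteq> lp_space p")
    case True
    then have "mball a e = {b \<in> lp_space p. lp_norm p (\<lambda>n. b n - a n) < e}" if "a \<in> V" for a e
      using ball that by blast
    then show ?thesis using True by (simp add: mopen_def Ball_def cong: imp_cong)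
  qed (simp add: mopen_def)
  then have "(\<lambda>V. V \<subseteq> lp_space p \<and>
     (\<forall>a\<in>V. \<exists>\<epsilon>>0. {b \<in> lp_space p. lp_norm p (\<lambda>n. b n - a n) < \<epsilon>} \<subseteq> V)) = mopen"
    by (rule ext)
  then show ?thesis by (simp add: lp_topology_def mtopology_def)
qed

lemma openin_lp_topology:
  assumes p: "1 \<le> p"
  shows "openin (lp_topology p) V \<longleftrightarrow> V \<subseteq> lp_space p \<and>
     (\<forall>a\<in>V. \<exists>e>0. {b \<in> lp_space p. lp_norm p (\<lambda>n. b n - a n) < e} \<subseteq> V)"
proof -
  interpret Metric_space "lp_space p"
    "\<lambda>a b. if a \<in> lp_space p \<and> b \<in> lp_space p then lp_norm p (\<lambda>n. a n - b n) else 0"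
    by (rule Metric_space_lp[OF p])
  have ball: "mball a e = {b \<in> lp_space p. lp_norm p (\<lambda>n. b n - a n) < e}"
    if "a \<in> lp_space p" for a e
    using that lp_norm_diff_commute[OF p, of a] by (auto simp: mball_def)
  show ?thesis
  proof (cases "V \<subseteq> lp_space p")
    case True
    then have "mball a e = {b \<in> lp_space p. lp_norm p (\<lambda>n. b n - a n) < e}" if "a \<in> V" for a e
      using ball that by blast
    then show ?thesis
      using True by (simp add: lp_topology_eq_mtopology[OF p] openin_mtopology Ball_def cong: imp_cong)
  qed (simp add: lp_topology_eq_mtopology[OF p] openin_mtopology)
qed

lemma topspace_lp_topology: "1 \<le> p \<Longrightarrow> topspace (lp_topology p) = lp_space p"
  by (simp add: lp_topology_eq_mtopology Metric_space.topspace_mtopology[OF Metric_space_lp])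

lemma openin_lp_ball:
  assumes p: "1 \<le> p" and a: "a \<in> lp_space p"
  shows "openin (lp_topology p) {b \<in> lp_space p. lp_norm p (\<lambda>n. b n - a n) < e}"
proof -
  interpret Metric_space "lp_space p"
    "\<lambda>a b. if a \<in> lp_space p \<and> b \<in> lp_space p then lp_norm p (\<lambda>n. a n - b n) else 0"
    by (rule Metric_space_lp[OF p])
  have "mball a e = {b \<in> lp_space p. lp_norm p (\<lambda>n. b n - a n) < e}"
    using a lp_norm_diff_commute[OF p, of a] by (auto simp: mball_def)
  then show ?thesis
    using openin_mball[of a e] by (simp only: lp_topology_eq_mtopology[OF p])
qed

text \<open>By completeness, compact closure amounts to total boundedness. It is through this
  criterion alone that compactness in the sequence spaces is used later.\<close>

lemma relatively_compact_lp_iff: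
  assumes p: "1 \<le> p" and A: "A \<subseteq> lp_space p"
  shows "relatively_compact_in (lp_topology p) A \<longleftrightarrow>
    (\<forall>e>0. \<exists>K. finite K \<and> K \<subseteq> A \<and> (\<forall>a\<in>A. \<exists>b\<in>K. lp_norm p (\<lambda>n. a n - b n) < e))"
proof -
  interpret Metric_space "lp_space p"
    "\<lambda>a b. if a \<in> lp_space p \<and> b \<in> lp_space p then lp_norm p (\<lambda>n. a n - b n) else 0"
    by (rule Metric_space_lp[OF p])
  have mcomplete
    unfolding mcomplete_def
  proof safe
    fix s assume s: "MCauchy s"
    have in_lp: "s k \<in> lp_space p" for k using s by (auto simp: MCauchy_def)
    have C: "\<exists>N. \<forall>k\<ge>N. \<forall>l\<ge>N. lp_norm p (\<lambda>n. s k n - s l n) < e" if "0 < e" for e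
      using s that in_lp by (auto simp: MCauchy_def)
    \<comment> \<open>Coordinates are dominated by the norm, so their limits exist and form the
      candidate limit.\<close>
    have "convergent (\<lambda>k. s k n)" for n
    proof (rule Cauchy_convergent, rule CauchyI)
      fix e :: real assume "0 < e"
      then show "\<exists>M. \<forall>m\<ge>M. \<forall>m'\<ge>M. norm (s m n - s m' n) < e"
        using C[of e] abs_le_lp_norm[OF p lp_diff[OF p in_lp in_lp]]
        by (metis order_le_less_trans real_norm_def)
    qed
    then obtain a where a: "\<And>n. (\<lambda>k. s k n) \<longlonglongrightarrow> a n"
      unfolding convergent_def by metis
    have a_lp: "a \<in> lp_space p" by (rule lp_limit(1)[OF p in_lp a C])
    have "\<exists>N. \<forall>k\<ge>N. lp_norm p (\<lambda>n. s k n - a n) < e" if "0 < e" for e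
      using lp_limit(2)[OF p in_lp a C, of "e / 2"] that by fastforce
    then have "limitin mtopology s a sequentially"
      using a_lp in_lp by (auto simp: limitin_metric eventually_sequentially)
    then show "\<exists>x. limitin mtopology s x sequentially" by blast
  qed
  then have "relatively_compact_in (lp_topology p) A \<longleftrightarrow> mtotally_bounded A"
    unfolding relatively_compact_in_def lp_topology_eq_mtopology[OF p]
    using mtotally_bounded_eq_compact_closure_of A by simp
  also have "\<dots> \<longleftrightarrow> (\<forall>e>0. \<exists>K. finite K \<and> K \<subseteq> A \<and>
      (\<forall>a\<in>A. \<exists>b\<in>K. lp_norm p (\<lambda>n. a n - b n) < e))"
  proof -
    have "A \<subseteq> (\<Union>x\<in>K. mball x e) \<longleftrightarrow> (\<forall>a\<in>A. \<exists>b\<in>K. lp_norm p (\<lambda>n. a n - b n) < e)"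
      if "K \<subseteq> A" for K e
    proof -
      have "a \<in> mball b e \<longleftrightarrow> lp_norm p (\<lambda>n. a n - b n) < e" if "a \<in> A" "b \<in> K" for a b
        using that \<open>K \<subseteq> A\<close> A lp_norm_diff_commute[OF p, of a b] by (auto simp: mball_def)
      then show ?thesis by blast
    qed
    then show ?thesis unfolding mtotally_bounded_def by (simp cong: conj_cong)
  qed
  finally show ?thesis .
qed

section \<open>The free locally convex space\<close>

text \<open>The linear extension of f to formal combinations, evaluated at u. With the support as
  index set, linearity in f is immediate, while linearity in u requires a common finite superset of
  the supports.\<close>

definition pairing :: "('a \<Rightarrow> real) \<Rightarrow> ('a \<Rightarrow> real) \<Rightarrow> real" where
  "pairing u f = (\<Sum>x | u x \<noteq> 0. u x * f x)"

definition weakly_bounded :: "'a topology \<Rightarrow> ('a \<Rightarrow> real) set \<Rightarrow> bool" where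
  "weakly_bounded X A \<longleftrightarrow> A \<subseteq> Lcarrier X \<and>
    (\<forall>f. continuous_map X euclideanreal f \<longrightarrow> (\<exists>B. \<forall>u\<in>A. \<bar>pairing u f\<bar> \<le> B))"

lemma pairing_superset:
  assumes "finite F" "{x. u x \<noteq> 0} \<subseteq> F"
  shows "pairing u f = (\<Sum>x\<in>F. u x * f x)"
  unfolding pairing_def using assms by (intro sum.mono_neutral_left) auto

lemma pairing_cong: "(\<And>x. u x \<noteq> 0 \<Longrightarrow> f x = g x) \<Longrightarrow> pairing u f = pairing u g"
  unfolding pairing_def by (intro sum.cong) auto

lemma pairing_add_right: "pairing u (\<lambda>x. f x + g x) = pairing u f + pairing u g"
  by (simp add: pairing_def algebra_simps sum.distrib)

lemma pairing_diff_right: "pairing u (\<lambda>x. f x - g x) = pairing u f - pairing u g"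
  by (simp add: pairing_def algebra_simps sum_subtractf)

lemma pairing_scale_right: "pairing u (\<lambda>x. c * f x) = c * pairing u f"
  by (simp add: pairing_def algebra_simps sum_distrib_left)

lemma finite_support: "u \<in> Lcarrier X \<Longrightarrow> finite {x. u x \<noteq> 0}"
  by (simp add: Lcarrier_def)

lemma support_subset_topspace: "u \<in> Lcarrier X \<Longrightarrow> u x \<noteq> 0 \<Longrightarrow> x \<in> topspace X"
  by (auto simp: Lcarrier_def)

lemma zero_in_Lcarrier [simp]: "(\<lambda>x. 0) \<in> Lcarrier X"
  by (simp add: Lcarrier_def)

lemma dirac_in_Lcarrier: "x \<in> topspace X \<Longrightarrow> dirac x \<in> Lcarrier X"
  by (auto simp: Lcarrier_def dirac_def)

lemma Lcarrier_add:
  assumes "u \<in> Lcarrier X" "v \<in> Lcarrier X"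
  shows "(\<lambda>x. u x + v x) \<in> Lcarrier X"
proof -
  have sub: "{x. u x + v x \<noteq> 0} \<subseteq> {x. u x \<noteq> 0} \<union> {x. v x \<noteq> 0}" by auto
  show ?thesis
    using assms finite_subset[OF sub] sub unfolding Lcarrier_def by blast
qed

lemma Lcarrier_scale: "u \<in> Lcarrier X \<Longrightarrow> (\<lambda>x. c * u x) \<in> Lcarrier X"
  using finite_subset[of "{x. c * u x \<noteq> 0}" "{x. u x \<noteq> 0}"]
  unfolding Lcarrier_def by fastforce

lemma Lcarrier_diff:
  assumes "u \<in> Lcarrier X" "v \<in> Lcarrier X"
  shows "(\<lambda>x. u x - v x) \<in> Lcarrier X"
  using Lcarrier_add[OF assms(1) Lcarrier_scale[OF assms(2), of "-1"]] by simp

lemma Lcarrier_sum: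
  assumes "finite F" "\<And>i. i \<in> F \<Longrightarrow> v i \<in> Lcarrier X"
  shows "(\<lambda>z. \<Sum>i\<in>F. c i * v i z) \<in> Lcarrier X"
  using assms
proof (induction F rule: finite_induct)
  case (insert i F)
  then show ?case using Lcarrier_add[OF Lcarrier_scale[of "v i" X "c i"] insert.IH] by simp
qed simp

lemma dirac_expansion:
  assumes "finite F" "{x. u x \<noteq> 0} \<subseteq> F"
  shows "u = (\<lambda>z. \<Sum>x\<in>F. u x * dirac x z)"
proof
  fix z
  have "(\<Sum>x\<in>F. u x * dirac x z) = (\<Sum>x\<in>F. if x = z then u x else 0)"
    by (intro sum.cong) (auto simp: dirac_def)
  also have "\<dots> = u z" using assms by (auto simp: sum.delta)
  finally show "u z = (\<Sum>x\<in>F. u x * dirac x z)" by simp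
qed

lemma pairing_dirac: "pairing (dirac x) f = f x"
  by (simp add: pairing_def dirac_def)

lemma pairing_add_left:
  assumes "u \<in> Lcarrier X" "v \<in> Lcarrier X"
  shows "pairing (\<lambda>x. u x + v x) f = pairing u f + pairing v f"
proof -
  define F where "F = {x. u x \<noteq> 0} \<union> {x. v x \<noteq> 0}"
  have F: "finite F" using assms by (simp add: F_def finite_support)
  have "pairing (\<lambda>x. u x + v x) f = (\<Sum>x\<in>F. (u x + v x) * f x)"
    by (rule pairing_superset[OF F]) (auto simp: F_def)
  also have "\<dots> = (\<Sum>x\<in>F. u x * f x) + (\<Sum>x\<in>F. v x * f x)"
    by (simp add: sum.distrib algebra_simps)
  also have "\<dots> = pairing u f + pairing v f"
    using pairing_superset[OF F, of u f] pairing_superset[OF F, of v f] by (auto simp: F_def)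
  finally show ?thesis .
qed

lemma pairing_scale_left: "pairing (\<lambda>x. c * u x) f = c * pairing u f"
  by (cases "c = 0") (auto simp: pairing_def sum_distrib_left algebra_simps)

lemma pairing_diff_left:
  assumes "u \<in> Lcarrier X" "v \<in> Lcarrier X"
  shows "pairing (\<lambda>x. u x - v x) f = pairing u f - pairing v f"
  using pairing_add_left[OF assms(1) Lcarrier_scale[OF assms(2), of "-1"], of f]
    pairing_scale_left[of "-1" v f] by simp

lemma pairing_sum_left:
  assumes "finite F" "\<And>i. i \<in> F \<Longrightarrow> v i \<in> Lcarrier X"
  shows "pairing (\<lambda>z. \<Sum>i\<in>F. c i * v i z) f = (\<Sum>i\<in>F. c i * pairing (v i) f)"
  using assms
proof (induction F rule: finite_induct)
  case empty then show ?case by (simp add: pairing_def)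
next
  case (insert i F)
  have "pairing (\<lambda>z. c i * v i z + (\<Sum>j\<in>F. c j * v j z)) f
      = pairing (\<lambda>z. c i * v i z) f + pairing (\<lambda>z. \<Sum>j\<in>F. c j * v j z) f"
    using insert by (intro pairing_add_left[of _ X] Lcarrier_scale Lcarrier_sum) auto
  then show ?case using insert by (simp add: pairing_scale_left)
qed

section \<open>Seminorms on L(X)\<close>

lemma seminorm_onD:
  assumes "seminorm_on S q"
  shows "u \<in> S \<Longrightarrow> 0 \<le> q u"
    and "u \<in> S \<Longrightarrow> v \<in> S \<Longrightarrow> q (\<lambda>x. u x + v x) \<le> q u + q v"
    and "u \<in> S \<Longrightarrow> q (\<lambda>x. c * u x) = \<bar>c\<bar> * q u"
  using assms unfolding seminorm_on_def by blast+

lemma seminorm_Lcarrier_sum: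
  assumes q: "seminorm_on (Lcarrier X) q"
    and F: "finite F" "\<And>i. i \<in> F \<Longrightarrow> v i \<in> Lcarrier X"
  shows "q (\<lambda>z. \<Sum>i\<in>F. c i * v i z) \<le> (\<Sum>i\<in>F. \<bar>c i\<bar> * q (v i))"
  using F
proof (induction F rule: finite_induct)
  case empty
  then show ?case using seminorm_onD(3)[OF q zero_in_Lcarrier, of 0] by simp
next
  case (insert i F)
  have "q (\<lambda>z. c i * v i z + (\<Sum>j\<in>F. c j * v j z))
      \<le> q (\<lambda>z. c i * v i z) + q (\<lambda>z. \<Sum>j\<in>F. c j * v j z)"
    using insert by (intro seminorm_onD(2)[OF q] Lcarrier_scale Lcarrier_sum) auto
  then show ?case
    using insert seminorm_onD(3)[OF q, of "v i" "c i"] by force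
qed

lemma seminorm_diff_triangle:
  assumes q: "seminorm_on (Lcarrier X) q"
    and "u \<in> Lcarrier X" "v \<in> Lcarrier X" "w \<in> Lcarrier X"
  shows "q (\<lambda>x. u x - w x) \<le> q (\<lambda>x. u x - v x) + q (\<lambda>x. v x - w x)"
  using seminorm_onD(2)[OF q Lcarrier_diff[OF assms(2,3)] Lcarrier_diff[OF assms(3,4)]] by simp

lemma seminorm_diff_commute:
  assumes q: "seminorm_on (Lcarrier X) q"
    and "u \<in> Lcarrier X" "v \<in> Lcarrier X"
  shows "q (\<lambda>x. u x - v x) = q (\<lambda>x. v x - u x)"
  using seminorm_onD(3)[OF q Lcarrier_diff[OF assms(2,3)], of "-1"] by simp

lemma seminorm_diff_self:
  assumes q: "seminorm_on (Lcarrier X) q"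
  shows "q (\<lambda>x. u x - u x) = 0"
  using seminorm_onD(3)[OF q zero_in_Lcarrier, of 0] by simp

lemma admissible_seminormD:
  assumes "admissible_seminorm X q"
  shows "seminorm_on (Lcarrier X) q"
    and "x \<in> topspace X \<Longrightarrow> 0 < e \<Longrightarrow>
      \<exists>U. openin X U \<and> x \<in> U \<and> (\<forall>y\<in>U. q (\<lambda>z. dirac y z - dirac x z) < e)"
  using assms unfolding admissible_seminorm_def by blast+

text \<open>The sum dominates both summands, so the family is directed: an intersection of two balls
  about a point contains a ball of the sum. This is what makes \<open>free_lc_topology\<close> a
  topology.\<close>

lemma admissible_seminorm_add:
  assumes a: "admissible_seminorm X q" and b: "admissible_seminorm X r"
  shows "admissible_seminorm X (\<lambda>u. q u + r u)"
  unfolding admissible_seminorm_def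
proof (intro conjI ballI allI impI)
  note q = admissible_seminormD(1)[OF a] and r = admissible_seminormD(1)[OF b]
  show "seminorm_on (Lcarrier X) (\<lambda>u. q u + r u)"
    unfolding seminorm_on_def
  proof (intro conjI ballI allI)
    fix u v c assume u: "u \<in> Lcarrier X"
    show "0 \<le> q u + r u" using seminorm_onD(1)[OF q u] seminorm_onD(1)[OF r u] by simp
    show "q (\<lambda>x. c * u x) + r (\<lambda>x. c * u x) = \<bar>c\<bar> * (q u + r u)"
      using seminorm_onD(3)[OF q u] seminorm_onD(3)[OF r u] by (simp add: algebra_simps)
    assume v: "v \<in> Lcarrier X"
    show "q (\<lambda>x. u x + v x) + r (\<lambda>x. u x + v x) \<le> q u + r u + (q v + r v)"
      using seminorm_onD(2)[OF q u v] seminorm_onD(2)[OF r u v] by simp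
  qed
  fix x and e :: real assume x: "x \<in> topspace X" and e: "0 < e"
  obtain U V where U: "openin X U" "x \<in> U" "\<forall>y\<in>U. q (\<lambda>z. dirac y z - dirac x z) < e / 2"
    and V: "openin X V" "x \<in> V" "\<forall>y\<in>V. r (\<lambda>z. dirac y z - dirac x z) < e / 2"
    using admissible_seminormD(2)[OF a x, of "e / 2"] admissible_seminormD(2)[OF b x, of "e / 2"] e
    by auto
  show "\<exists>U. openin X U \<and> x \<in> U \<and>
      (\<forall>y\<in>U. q (\<lambda>z. dirac y z - dirac x z) + r (\<lambda>z. dirac y z - dirac x z) < e)"
    using U V by (intro exI[of _ "U \<inter> V"]) (force intro: openin_Int)
qed

text \<open>On differences of Dirac functions this seminorm is \<open>\<bar>f y - f x\<bar>\<close>.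
  It is the source of all concrete neighbourhoods below: for separation, for weak boundedness and
  for the test operators.\<close>

lemma admissible_seminorm_pairing:
  assumes f: "continuous_map X euclideanreal f"
  shows "admissible_seminorm X (\<lambda>u. \<bar>pairing u f\<bar>)"
  unfolding admissible_seminorm_def
proof (intro conjI ballI allI impI)
  show "seminorm_on (Lcarrier X) (\<lambda>u. \<bar>pairing u f\<bar>)"
    unfolding seminorm_on_def by (auto simp: pairing_add_left pairing_scale_left abs_mult)
  fix x and e :: real assume x: "x \<in> topspace X" and e: "0 < e"
  have "continuous_map X Met_TC.mtopology f" using f by simp
  then obtain U where U: "openin X U" "x \<in> U" "\<forall>y\<in>U. f y \<in> Met_TC.mball (f x) e"
    unfolding Met_TC.continuous_map_to_metric using x e by meson
  have "\<bar>pairing (\<lambda>z. dirac y z - dirac x z) f\<bar> < e" if "y \<in> U" for y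
    using U that x openin_subset[OF U(1)]
    by (subst pairing_diff_left[of _ X])
       (auto simp: pairing_dirac dist_real_def abs_minus_commute intro: dirac_in_Lcarrier)
  then show "\<exists>U. openin X U \<and> x \<in> U \<and>
      (\<forall>y\<in>U. \<bar>pairing (\<lambda>z. dirac y z - dirac x z) f\<bar> < e)"
    using U by blast
qed

section \<open>The topology generated by the admissible seminorms\<close>

lemma openin_free_lc_topology:
  "openin (free_lc_topology X) V \<longleftrightarrow> V \<subseteq> Lcarrier X \<and>
     (\<forall>u\<in>V. \<exists>q e. admissible_seminorm X q \<and> e > 0 \<and>
        {v \<in> Lcarrier X. q (\<lambda>x. v x - u x) < e} \<subseteq> V)"
proof -
  have top: "istopology (\<lambda>V. V \<subseteq> Lcarrier X \<and>
     (\<forall>u\<in>V. \<exists>q e. admissible_seminorm X q \<and> e > 0 \<and>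
        {v \<in> Lcarrier X. q (\<lambda>x. v x - u x) < e} \<subseteq> V))"
    unfolding istopology_def
  proof (intro conjI allI impI)
    fix S T assume S: "S \<subseteq> Lcarrier X \<and> (\<forall>u\<in>S. \<exists>q e. admissible_seminorm X q \<and> e > 0 \<and>
        {v \<in> Lcarrier X. q (\<lambda>x. v x - u x) < e} \<subseteq> S)"
      and T: "T \<subseteq> Lcarrier X \<and> (\<forall>u\<in>T. \<exists>q e. admissible_seminorm X q \<and> e > 0 \<and>
        {v \<in> Lcarrier X. q (\<lambda>x. v x - u x) < e} \<subseteq> T)"
    show "S \<inter> T \<subseteq> Lcarrier X" using S by blast
    show "\<forall>u\<in>S \<inter> T. \<exists>q e. admissible_seminorm X q \<and> e > 0 \<and>
        {v \<in> Lcarrier X. q (\<lambda>x. v x - u x) < e} \<subseteq> S \<inter> T"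
    proof
      fix u assume u: "u \<in> S \<inter> T"
      obtain q d where q: "admissible_seminorm X q" "d > 0"
        "{v \<in> Lcarrier X. q (\<lambda>x. v x - u x) < d} \<subseteq> S" using S u by blast
      obtain r e where r: "admissible_seminorm X r" "e > 0"
        "{v \<in> Lcarrier X. r (\<lambda>x. v x - u x) < e} \<subseteq> T" using T u by blast
      have "v \<in> S \<inter> T" if v: "v \<in> Lcarrier X"
        and le: "q (\<lambda>x. v x - u x) + r (\<lambda>x. v x - u x) < min d e" for v
      proof -
        have d: "(\<lambda>x. v x - u x) \<in> Lcarrier X" using v u S by (blast intro: Lcarrier_diff)
        have "0 \<le> q (\<lambda>x. v x - u x)" "0 \<le> r (\<lambda>x. v x - u x)"
          using seminorm_onD(1)[OF admissible_seminormD(1) d] q(1) r(1) by blast+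
        then have "q (\<lambda>x. v x - u x) < d" "r (\<lambda>x. v x - u x) < e" using le by linarith+
        then show ?thesis using q(3) r(3) v by blast
      qed
      then show "\<exists>q e. admissible_seminorm X q \<and> e > 0 \<and>
          {v \<in> Lcarrier X. q (\<lambda>x. v x - u x) < e} \<subseteq> S \<inter> T"
        using admissible_seminorm_add[OF q(1) r(1)] q(2) r(2)
        by (intro exI[of _ "\<lambda>u. q u + r u"] exI[of _ "min d e"]) auto
    qed
  next
    fix \<K> assume K: "\<forall>K\<in>\<K>. K \<subseteq> Lcarrier X \<and> (\<forall>u\<in>K. \<exists>q e. admissible_seminorm X q \<and> e > 0 \<and>
        {v \<in> Lcarrier X. q (\<lambda>x. v x - u x) < e} \<subseteq> K)"
    show "\<Union>\<K> \<subseteq> Lcarrier X" using K by blast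
    show "\<forall>u\<in>\<Union>\<K>. \<exists>q e. admissible_seminorm X q \<and> e > 0 \<and>
        {v \<in> Lcarrier X. q (\<lambda>x. v x - u x) < e} \<subseteq> \<Union>\<K>"
    proof
      fix u assume "u \<in> \<Union>\<K>"
      then obtain K where KK: "K \<in> \<K>" "u \<in> K" by blast
      then obtain q e where "admissible_seminorm X q" "e > 0"
        "{v \<in> Lcarrier X. q (\<lambda>x. v x - u x) < e} \<subseteq> K"
        using K by blast
      moreover have "K \<subseteq> \<Union>\<K>" using KK by blast
      ultimately show "\<exists>q e. admissible_seminorm X q \<and> e > 0 \<and>
          {v \<in> Lcarrier X. q (\<lambda>x. v x - u x) < e} \<subseteq> \<Union>\<K>"
        by (meson subset_trans)
    qed
  qed
  show ?thesis unfolding free_lc_topology_def by (rule fun_cong[OF topology_inverse'[OF top]])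
qed

lemma openin_free_lc_ball:
  assumes q: "admissible_seminorm X q" and u: "u \<in> Lcarrier X"
  shows "openin (free_lc_topology X) {v \<in> Lcarrier X. q (\<lambda>x. v x - u x) < e}"
  unfolding openin_free_lc_topology
proof (intro conjI ballI)
  fix v assume "v \<in> {v \<in> Lcarrier X. q (\<lambda>x. v x - u x) < e}"
  then have v: "v \<in> Lcarrier X" "q (\<lambda>x. v x - u x) < e" by auto
  have "q (\<lambda>x. w x - u x) < e"
    if "w \<in> Lcarrier X" "q (\<lambda>x. w x - v x) < e - q (\<lambda>x. v x - u x)" for w
    using seminorm_diff_triangle[OF admissible_seminormD(1)[OF q] that(1) v(1) u] that(2) by linarith
  then have "{w \<in> Lcarrier X. q (\<lambda>x. w x - v x) < e - q (\<lambda>x. v x - u x)}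
      \<subseteq> {v \<in> Lcarrier X. q (\<lambda>x. v x - u x) < e}"
    by blast
  moreover have "0 < e - q (\<lambda>x. v x - u x)" using v by simp
  ultimately show "\<exists>q' d. admissible_seminorm X q' \<and> d > 0 \<and>
      {w \<in> Lcarrier X. q' (\<lambda>x. w x - v x) < d} \<subseteq> {v \<in> Lcarrier X. q (\<lambda>x. v x - u x) < e}"
    using q by meson
qed blast

lemma topspace_free_lc_topology [simp]: "topspace (free_lc_topology X) = Lcarrier X"
proof -
  \<comment> \<open>Openness of the whole carrier requires that some admissible seminorm exists; the
    zero function supplies one.\<close>
  have "admissible_seminorm X (\<lambda>u. \<bar>pairing u (\<lambda>x. 0)\<bar>)"
    by (rule admissible_seminorm_pairing) simp
  then have "openin (free_lc_topology X) (Lcarrier X)"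
    unfolding openin_free_lc_topology using zero_less_one by blast
  moreover have "openin (free_lc_topology X) U \<Longrightarrow> U \<subseteq> Lcarrier X" for U
    unfolding openin_free_lc_topology by blast
  ultimately show ?thesis
    by (simp add: openin_subset subset_antisym)
qed

section \<open>Separation by continuous functions\<close>

lemma completely_regular_bump:
  assumes "completely_regular_space X" "closedin X S" "x \<in> topspace X" "x \<notin> S"
  obtains g :: "'a \<Rightarrow> real" where "continuous_map X euclideanreal g" "g x = 1"
    "\<And>y. y \<in> S \<Longrightarrow> g y = 0" "\<And>y. y \<in> topspace X \<Longrightarrow> 0 \<le> g y" "\<And>y. y \<in> topspace X \<Longrightarrow> g y \<le> 1"
proof -
  obtain f :: "'a \<Rightarrow> real" where f: "continuous_map X (top_of_set {0..1}) f" "f x = 0" "f ` S \<subseteq> {1}"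
    using assms unfolding completely_regular_space_def by blast
  then have c: "continuous_map X euclideanreal f" and r: "f \<in> topspace X \<rightarrow> {0..1}"
    by (auto simp: continuous_map_in_subtopology)
  show ?thesis
  proof (rule that[of "\<lambda>y. 1 - f y"])
    show "continuous_map X euclideanreal (\<lambda>y. 1 - f y)"
      using c by (intro continuous_map_diff) auto
  qed (use f r in \<open>auto simp: Pi_iff\<close>)
qed

lemma finite_bump:
  assumes "completely_regular_space X" "Hausdorff_space X" "finite F" "F \<subseteq> topspace X" "x \<in> topspace X" "x \<notin> F"
  obtains g :: "'a \<Rightarrow> real" where "continuous_map X euclideanreal g" "g x = 1"
    "\<And>y. y \<in> F \<Longrightarrow> g y = 0" "\<And>y. y \<in> topspace X \<Longrightarrow> 0 \<le> g y" "\<And>y. y \<in> topspace X \<Longrightarrow> g y \<le> 1"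
  using completely_regular_bump[OF assms(1) closedin_Hausdorff_finite[OF assms(2,4,3)] assms(5,6)] by blast

text \<open>A bump that is 1 at x and 0 at the other support points of u and v reads off the
  coefficient at x, so two elements with different coefficients there lie in disjoint balls of the
  corresponding seminorm.\<close>

lemma Hausdorff_free_lc_topology:
  assumes X: "completely_regular_space X" "Hausdorff_space X"
  shows "Hausdorff_space (free_lc_topology X)"
  unfolding Hausdorff_space_def
proof (intro allI impI, elim conjE)
  fix u v assume uv: "u \<in> topspace (free_lc_topology X)" "v \<in> topspace (free_lc_topology X)" "u \<noteq> v"
  then obtain x where x: "u x \<noteq> v x" by blast
  define F where "F = ({y. u y \<noteq> 0} \<union> {y. v y \<noteq> 0}) - {x}"
  have F: "finite F" "F \<subseteq> topspace X" "x \<in> topspace X"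
    using uv x support_subset_topspace[of u X] support_subset_topspace[of v X]
    by (auto simp: F_def finite_support) (metis)
  obtain g where g: "continuous_map X euclideanreal g" "g x = 1" "\<And>y. y \<in> F \<Longrightarrow> g y = 0"
    using finite_bump[OF X F, of thesis] by (auto simp: F_def)
  have val: "pairing w g = w x" if w: "{y. w y \<noteq> 0} \<subseteq> insert x F" for w
  proof -
    have "pairing w g = (\<Sum>y\<in>insert x F. w y * g y)"
      using F w by (intro pairing_superset) auto
    also have "\<dots> = w x * g x + (\<Sum>y\<in>F. w y * g y)"
      using F by (intro sum.insert) (auto simp: F_def)
    also have "(\<Sum>y\<in>F. w y * g y) = 0"
      using g(3) by (intro sum.neutral) simp
    finally show ?thesis using g(2) by simp
  qed
  have pu: "pairing u g = u x" "pairing v g = v x" using val by (auto simp: F_def)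
  define q where "q w = \<bar>pairing w g\<bar>" for w
  have q: "admissible_seminorm X q"
    unfolding q_def by (rule admissible_seminorm_pairing[OF g(1)])
  define e where "e = \<bar>u x - v x\<bar> / 2"
  have e: "0 < e" using x by (simp add: e_def)
  define U where "U w = {z \<in> Lcarrier X. q (\<lambda>x. z x - w x) < e}" for w
  have "w \<in> U w" if "w \<in> Lcarrier X" for w
    using that e by (simp add: U_def q_def pairing_def)
  moreover have "openin (free_lc_topology X) (U w)" if "w \<in> Lcarrier X" for w
    unfolding U_def using openin_free_lc_ball[OF q that] .
  moreover have "disjnt (U u) (U v)"
  proof -
    have False if "z \<in> U u" "z \<in> U v" for z
    proof -
      have "\<bar>pairing z g - pairing u g\<bar> < e" "\<bar>pairing z g - pairing v g\<bar> < e"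
        using that uv unfolding U_def q_def by (auto simp: pairing_diff_left[of _ X])
      moreover have "\<bar>u x - v x\<bar> = e + e" by (simp add: e_def)
      ultimately show False unfolding pu by linarith
    qed
    then show ?thesis by (auto simp: disjnt_def)
  qed
  ultimately show "\<exists>U V. openin (free_lc_topology X) U \<and> openin (free_lc_topology X) V \<and>
      u \<in> U \<and> v \<in> V \<and> disjnt U V"
    using uv by (metis topspace_free_lc_topology)
qed

text \<open>The box is the image of the cube \<open>{-C..C}\<close> to the power F under the map
  \<open>h\<close> from coordinates to combinations of Dirac functions. For continuity of
  \<open>h\<close>, every seminorm is controlled on these combinations by its finitely many values
  \<open>q (dirac x)\<close>.\<close>

lemma compactin_finite_dimensional_box:
  assumes F: "finite F" "F \<subseteq> topspace X" and C: "0 \<le> C"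
  shows "compactin (free_lc_topology X) {u. {x. u x \<noteq> 0} \<subseteq> F \<and> (\<forall>x. \<bar>u x\<bar> \<le> C)}"
proof -
  define P where "P = product_topology (\<lambda>_::'a. euclideanreal) F"
  define h where "h a = (\<lambda>z. \<Sum>x\<in>F. a x * dirac x z)" for a :: "'a \<Rightarrow> real"
  have d: "dirac x \<in> Lcarrier X" if "x \<in> F" for x using that F(2) by (intro dirac_in_Lcarrier) blast
  have hL: "h a \<in> Lcarrier X" for a
    unfolding h_def using F d by (intro Lcarrier_sum) auto
  have "continuous_map P (free_lc_topology X) h"
    unfolding continuous_map_def
  proof (intro conjI allI impI)
    show "h \<in> topspace P \<rightarrow> topspace (free_lc_topology X)" using hL by simp
    fix V assume V: "openin (free_lc_topology X) V"
    show "openin P {a \<in> topspace P. h a \<in> V}"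
    proof (subst openin_subopen, intro ballI)
      fix a assume a: "a \<in> {a \<in> topspace P. h a \<in> V}"
      obtain q e where q: "admissible_seminorm X q" "e > 0"
        "{v \<in> Lcarrier X. q (\<lambda>x. v x - h a x) < e} \<subseteq> V"
        using V a unfolding openin_free_lc_topology by blast
      note sq = admissible_seminormD(1)[OF q(1)]
      define Q where "Q = (\<Sum>x\<in>F. q (dirac x))"
      have Q: "0 \<le> Q" unfolding Q_def using d by (intro sum_nonneg seminorm_onD(1)[OF sq])
      \<comment> \<open>The \<open>+ 1\<close> keeps the radius meaningful for \<open>Q = 0\<close>
        and makes \<open>t * Q < e\<close> strict.\<close>
      define t where "t = e / (Q + 1)"
      have t: "0 < t" using q Q by (simp add: t_def)
      define T where "T = (\<Pi>\<^sub>E x\<in>F. ball (a x) t)"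
      have "openin P T"
        unfolding P_def T_def using F by (subst openin_PiE) auto
      moreover have "a \<in> T" using a t by (auto simp: T_def P_def PiE_iff)
      moreover have "T \<subseteq> {a \<in> topspace P. h a \<in> V}"
      proof
        fix b assume b: "b \<in> T"
        have "(\<lambda>z. h b z - h a z) = (\<lambda>z. \<Sum>x\<in>F. (b x - a x) * dirac x z)"
          by (simp add: h_def algebra_simps sum_subtractf)
        then have "q (\<lambda>z. h b z - h a z) \<le> (\<Sum>x\<in>F. \<bar>b x - a x\<bar> * q (dirac x))"
          using seminorm_Lcarrier_sum[OF sq F(1), of dirac "\<lambda>x. b x - a x"] d by simp
        also have "\<dots> \<le> (\<Sum>x\<in>F. t * q (dirac x))"
          using b d seminorm_onD(1)[OF sq]
          by (intro sum_mono mult_right_mono)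
             (auto simp: T_def PiE_iff dist_real_def abs_minus_commute less_imp_le)
        also have "\<dots> = t * Q" by (simp add: Q_def sum_distrib_left)
        also have "\<dots> < e" using q(2) Q by (simp add: t_def field_simps)
        finally have "h b \<in> V" using q(3) hL by blast
        then show "b \<in> {a \<in> topspace P. h a \<in> V}" using b by (auto simp: T_def P_def PiE_iff)
      qed
      ultimately show "\<exists>T. openin P T \<and> a \<in> T \<and> T \<subseteq> {a \<in> topspace P. h a \<in> V}" by blast
    qed
  qed
  moreover have "compactin P (\<Pi>\<^sub>E x\<in>F. {-C..C})"
    unfolding P_def by (subst compactin_PiE) auto
  ultimately have "compactin (free_lc_topology X) (h ` (\<Pi>\<^sub>E x\<in>F. {-C..C}))"
    by (rule image_compactin[rotated])
  moreover have "h ` (\<Pi>\<^sub>E x\<in>F. {-C..C}) = {u. {x. u x \<noteq> 0} \<subseteq> F \<and> (\<forall>x. \<bar>u x\<bar> \<le> C)}"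
  proof -
    have h: "h a z = (if z \<in> F then a z else 0)" for a z
    proof -
      have "h a z = (\<Sum>x\<in>F. if x = z then a x else 0)"
        unfolding h_def by (intro sum.cong) (auto simp: dirac_def)
      then show ?thesis using F by simp
    qed
    show ?thesis
    proof (intro equalityI subsetI)
      fix u assume "u \<in> h ` (\<Pi>\<^sub>E x\<in>F. {-C..C})"
      then show "u \<in> {u. {x. u x \<noteq> 0} \<subseteq> F \<and> (\<forall>x. \<bar>u x\<bar> \<le> C)}"
        using C by (auto simp: h PiE_iff abs_le_iff split: if_splits) (smt (verit))+
    next
      fix u assume u: "u \<in> {u. {x. u x \<noteq> 0} \<subseteq> F \<and> (\<forall>x. \<bar>u x\<bar> \<le> C)}"
      then have "u = h (restrict u F)" by (auto simp: h fun_eq_iff)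
      moreover have "restrict u F \<in> (\<Pi>\<^sub>E x\<in>F. {-C..C})"
        using u by (auto simp: abs_le_iff) (smt (verit))+
      ultimately show "u \<in> h ` (\<Pi>\<^sub>E x\<in>F. {-C..C})" by blast
    qed
  qed
  ultimately show ?thesis by simp
qed

text \<open>Pulls the norm back along T, so that a finite net for this seminorm on L(X) becomes a
  norm net of the image.\<close>

lemma admissible_seminorm_lp_operator:
  assumes p: "1 \<le> p" and lin: "linear_on (Lcarrier X) T"
    and cont: "continuous_map (free_lc_topology X) (lp_topology p) T"
  shows "admissible_seminorm X (\<lambda>u. lp_norm p (T u))"
    and "u \<in> Lcarrier X \<Longrightarrow> T u \<in> lp_space p"
    and "u \<in> Lcarrier X \<Longrightarrow> v \<in> Lcarrier X \<Longrightarrow> T (\<lambda>x. u x - v x) = (\<lambda>n. T u n - T v n)"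
proof -
  have lp: "T u \<in> lp_space p" if "u \<in> Lcarrier X" for u
    using cont that by (auto simp: continuous_map_def topspace_lp_topology[OF p])
  have add: "T (\<lambda>x. u x + v x) = (\<lambda>n. T u n + T v n)"
    and scale: "T (\<lambda>x. c * u x) = (\<lambda>n. c * T u n)"
    if "u \<in> Lcarrier X" "v \<in> Lcarrier X" for u v c
    using lin that unfolding linear_on_def by blast+
  have diff: "T (\<lambda>x. u x - v x) = (\<lambda>n. T u n - T v n)"
    if "u \<in> Lcarrier X" "v \<in> Lcarrier X" for u v
    using add[OF that(1) Lcarrier_scale[OF that(2), of "-1"]] scale[OF that(2,2), of "-1"] by simp
  show "u \<in> Lcarrier X \<Longrightarrow> T u \<in> lp_space p" using lp .
  show "u \<in> Lcarrier X \<Longrightarrow> v \<in> Lcarrier X \<Longrightarrow> T (\<lambda>x. u x - v x) = (\<lambda>n. T u n - T v n)" using diff .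
  show "admissible_seminorm X (\<lambda>u. lp_norm p (T u))"
    unfolding admissible_seminorm_def
  proof (intro conjI ballI allI impI)
    show "seminorm_on (Lcarrier X) (\<lambda>u. lp_norm p (T u))"
      unfolding seminorm_on_def
      using lp_norm_nonneg[OF p lp] lp_add(2)[OF p lp lp] lp_scale(2)[OF p lp]
      by (auto simp: add scale)
    fix x and e :: real assume x: "x \<in> topspace X" and e: "0 < e"
    note dx = dirac_in_Lcarrier[OF x]
    define B where "B = {b \<in> lp_space p. lp_norm p (\<lambda>n. b n - T (dirac x) n) < e}"
    have "openin (lp_topology p) B" unfolding B_def by (rule openin_lp_ball[OF p lp[OF dx]])
    then have "openin (free_lc_topology X) {u \<in> Lcarrier X. T u \<in> B}"
      using cont by (simp add: continuous_map_def)
    moreover have "dirac x \<in> {u \<in> Lcarrier X. T u \<in> B}"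
      using dx lp[OF dx] e lp_scale(2)[OF p lp[OF dx], of 0] by (simp add: B_def)
    \<comment> \<open>Continuity of T at \<open>dirac x\<close> yields a ball of some admissible q,
      and admissibility of q turns this ball into a neighbourhood of x in X.\<close>
    ultimately obtain q d where q: "admissible_seminorm X q" "d > 0"
      "{v \<in> Lcarrier X. q (\<lambda>z. v z - dirac x z) < d} \<subseteq> {u \<in> Lcarrier X. T u \<in> B}"
      unfolding openin_free_lc_topology by blast
    obtain U where U: "openin X U" "x \<in> U" "\<forall>y\<in>U. q (\<lambda>z. dirac y z - dirac x z) < d"
      using admissible_seminormD(2)[OF q(1) x q(2)] by blast
    have "lp_norm p (T (\<lambda>z. dirac y z - dirac x z)) < e" if y: "y \<in> U" for y
    proof -
      have dy: "dirac y \<in> Lcarrier X" using y openin_subset[OF U(1)] by (intro dirac_in_Lcarrier) blast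
      then have "T (dirac y) \<in> B" using q(3) U y by blast
      then show ?thesis using diff[OF dy dx] by (simp add: B_def)
    qed
    then show "\<exists>U. openin X U \<and> x \<in> U \<and> (\<forall>y\<in>U. lp_norm p (T (\<lambda>z. dirac y z - dirac x z)) < e)"
      using U by blast
  qed
qed

section \<open>Weakly bounded sets\<close>

text \<open>Serves for infinite constructions that, near each point, coincide with one globally
  continuous function.\<close>

lemma continuous_map_locally_eq:
  assumes "\<And>x. x \<in> topspace X \<Longrightarrow>
    \<exists>U g. openin X U \<and> x \<in> U \<and> continuous_map X Y g \<and> (\<forall>y\<in>U. h y = g y)"
  shows "continuous_map X Y h"
  unfolding continuous_map_def
proof (intro conjI allI impI)
  show "h \<in> topspace X \<rightarrow> topspace Y"
  proof
    fix x assume x: "x \<in> topspace X"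
    from assms[OF x] obtain U g where "x \<in> U" "continuous_map X Y g" "\<forall>y\<in>U. h y = g y" by blast
    then show "h x \<in> topspace Y" using x by (auto simp: continuous_map_def Pi_iff)
  qed
  fix V assume V: "openin Y V"
  show "openin X {x \<in> topspace X. h x \<in> V}"
  proof (subst openin_subopen, intro ballI)
    fix x assume x: "x \<in> {x \<in> topspace X. h x \<in> V}"
    then obtain U g where U: "openin X U" "x \<in> U" "continuous_map X Y g" "\<forall>y\<in>U. h y = g y"
      using assms[of x] by blast
    have "openin X (U \<inter> {y \<in> topspace X. g y \<in> V})"
      using U V by (intro openin_Int) (auto simp: continuous_map_def)
    moreover have "x \<in> U \<inter> {y \<in> topspace X. g y \<in> V}" using U x by auto
    moreover have "U \<inter> {y \<in> topspace X. g y \<in> V} \<subseteq> {x \<in> topspace X. h x \<in> V}" using U by auto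
    ultimately show "\<exists>T. openin X T \<and> x \<in> T \<and> T \<subseteq> {x \<in> topspace X. h x \<in> V}" by blast
  qed
qed

text \<open>One step of the gliding hump. The bump \<open>g\<close> vanishes where
  \<open>f \<le> M\<close> and at every support point of u except x, so it pairs with u to the
  single coefficient \<open>u x\<close>. A multiple of it can then give the pairing any value
  without changing h where \<open>f \<le> M\<close>.\<close>

lemma support_hump:
  assumes X: "completely_regular_space X" "Hausdorff_space X"
    and A: "A \<subseteq> Lcarrier X"
    and f: "continuous_map X euclideanreal f"
    and unbdd: "\<exists>u\<in>A. \<exists>x. u x \<noteq> 0 \<and> M < f x"
    and h: "continuous_map X euclideanreal h"
  shows "\<exists>u\<in>A. \<exists>h'. continuous_map X euclideanreal h' \<and>
    (\<forall>y\<in>topspace X. f y \<le> M \<longrightarrow> h' y = h y) \<and> c \<le> \<bar>pairing u h'\<bar>"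
proof -
  obtain u x where u: "u \<in> A" "u x \<noteq> 0" "M < f x" using unbdd by blast
  have uL: "u \<in> Lcarrier X" using u A by blast
  define F where "F = {y. u y \<noteq> 0} - {x}"
  have F: "finite F" "F \<subseteq> topspace X" "x \<in> topspace X"
    using uL u by (auto simp: F_def Lcarrier_def)
  have "closedin X {y \<in> topspace X. f y \<in> {..M}}"
    by (rule closedin_continuous_map_preimage[OF f]) simp
  then have "closedin X ({y \<in> topspace X. f y \<in> {..M}} \<union> F)"
    using closedin_Hausdorff_finite[OF X(2) F(2,1)] by (rule closedin_Un)
  then obtain g where g: "continuous_map X euclideanreal g" "g x = 1"
    "\<And>y. y \<in> {y \<in> topspace X. f y \<in> {..M}} \<union> F \<Longrightarrow> g y = 0"
    using completely_regular_bump[OF X(1) _ F(3)] u(3)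
    by (metis (no_types, lifting) F_def UnE DiffD2 insertI1 mem_Collect_eq atMost_iff not_le)
  have "pairing u g = (\<Sum>y\<in>insert x F. u y * g y)"
    using F by (intro pairing_superset) (auto simp: F_def)
  also have "\<dots> = u x * g x + (\<Sum>y\<in>F. u y * g y)"
    using F by (intro sum.insert) (auto simp: F_def)
  also have "(\<Sum>y\<in>F. u y * g y) = 0" using g(3) by (intro sum.neutral) simp
  finally have pg: "pairing u g = u x" using g(2) by simp
  \<comment> \<open>The solution of \<open>pairing u h + t * u x = \<bar>c\<bar>\<close>.\<close>
  define t where "t = (\<bar>c\<bar> - pairing u h) / u x"
  define h' where "h' y = h y + t * g y" for y
  have "continuous_map X euclideanreal h'"
    unfolding h'_def using h g(1) by (intro continuous_map_add continuous_map_real_mult) auto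
  moreover have "\<forall>y\<in>topspace X. f y \<le> M \<longrightarrow> h' y = h y"
    using g(3) by (simp add: h'_def)
  moreover have "pairing u h' = \<bar>c\<bar>"
    unfolding h'_def pairing_add_right pairing_scale_right pg using u by (simp add: t_def)
  ultimately show ?thesis
    using u(1) by (intro bexI[of _ u] exI[of _ h']) auto
qed

text \<open>Gliding hump: if some continuous \<open>f\<close> were unbounded on the supports, humps placed at
  points with larger and larger \<open>f\<close>-value, each beyond all supports used before, would form a
  locally finite sum that is unbounded on \<open>A\<close>.\<close>

lemma weakly_bounded_support:
  assumes X: "completely_regular_space X" "Hausdorff_space X"
    and A: "weakly_bounded X A"
  shows "functionally_bounded X {x. \<exists>u\<in>A. u x \<noteq> 0}"
proof -
  have AL: "A \<subseteq> Lcarrier X" using A by (simp add: weakly_bounded_def)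
  have bdd: "\<exists>M. \<forall>u\<in>A. \<forall>x. u x \<noteq> 0 \<longrightarrow> f x \<le> M" if f: "continuous_map X euclideanreal f" for f
  proof (rule ccontr)
    assume "\<not> (\<exists>M. \<forall>u\<in>A. \<forall>x. u x \<noteq> 0 \<longrightarrow> f x \<le> M)"
    then have unbdd: "\<exists>u\<in>A. \<exists>x. u x \<noteq> 0 \<and> M < f x" for M by (meson not_le)
    define P where "P n s = (case s of (M, h, u) \<Rightarrow> real n \<le> M \<and> continuous_map X euclideanreal h \<and>
      (0 < n \<longrightarrow> u \<in> A \<and> real n \<le> \<bar>pairing u h\<bar> \<and> (\<forall>x. u x \<noteq> 0 \<longrightarrow> f x \<le> M)))"
      for n :: nat and s :: "real \<times> ('a \<Rightarrow> real) \<times> ('a \<Rightarrow> real)"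
    define Q where "Q s s' = (case s of (M, h, u) \<Rightarrow> case s' of (M', h', u') \<Rightarrow>
      M \<le> M' \<and> (\<forall>y\<in>topspace X. f y \<le> M \<longrightarrow> h' y = h y))"
      for s s' :: "real \<times> ('a \<Rightarrow> real) \<times> ('a \<Rightarrow> real)"
    have "\<exists>s. \<forall>n. P n (s n) \<and> Q (s n) (s (Suc n))"
    proof (rule dependent_nat_choice)
      show "\<exists>s. P 0 s" by (rule exI[of _ "(0, \<lambda>_. 0, \<lambda>_. 0)"]) (simp add: P_def)
      fix s n assume s: "P n s"
      obtain M h u where sM: "s = (M, h, u)" by (cases s)
      have M: "real n \<le> M" and h: "continuous_map X euclideanreal h" using s by (auto simp: P_def sM)
      obtain u' h' where u': "u' \<in> A" and h': "continuous_map X euclideanreal h'"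
        "\<forall>y\<in>topspace X. f y \<le> M \<longrightarrow> h' y = h y" "real (Suc n) \<le> \<bar>pairing u' h'\<bar>"
        using support_hump[OF X AL f unbdd h] by blast
      have "finite {x. u' x \<noteq> 0}" using u' AL finite_support by blast
      then have "bdd_above (f ` {x. u' x \<noteq> 0})" by simp
      then obtain B where B: "\<forall>x. u' x \<noteq> 0 \<longrightarrow> f x \<le> B" unfolding bdd_above_def by auto
      \<comment> \<open>\<open>M + 1\<close> drives the levels to infinity, and \<open>B\<close>
        protects the support of \<open>u'\<close>, so that later humps leave
        \<open>pairing u' h'\<close> intact.\<close>
      have "P (Suc n) (max (M + 1) B, h', u')" "Q s (max (M + 1) B, h', u')"
        using u' h' B M by (auto simp: P_def Q_def sM max_def intro: order_trans)
      then show "\<exists>s'. P (Suc n) s' \<and> Q s s'" by blast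
    qed
    then obtain s where s: "\<And>n. P n (s n)" "\<And>n. Q (s n) (s (Suc n))" by blast
    define M h u where "M n = fst (s n)" and "h n = fst (snd (s n))" and "u n = snd (snd (s n))" for n
    have M: "real n \<le> M n" and h: "continuous_map X euclideanreal (h n)"
      and u: "0 < n \<Longrightarrow> u n \<in> A" "0 < n \<Longrightarrow> real n \<le> \<bar>pairing (u n) (h n)\<bar>"
        "0 < n \<Longrightarrow> u n x \<noteq> 0 \<Longrightarrow> f x \<le> M n" for n x
      using s(1)[of n] by (auto simp: P_def M_def h_def u_def split: prod.splits)
    have Mmono: "M n \<le> M (Suc n)"
      and hstep: "y \<in> topspace X \<Longrightarrow> f y \<le> M n \<Longrightarrow> h (Suc n) y = h n y" for n y
      using s(2)[of n] by (auto simp: Q_def M_def h_def split: prod.splits)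
    have stable: "h k y = h n y \<and> f y \<le> M k" if "n \<le> k" "y \<in> topspace X" "f y \<le> M n" for k n y
      using that(1)
    proof (induction k rule: dec_induct)
      case (step k)
      then show ?case using hstep[OF that(2), of k] Mmono[of k] by linarith
    qed (use that in simp)
    \<comment> \<open>The value \<open>h k y\<close> is the same for all k with
      \<open>f y \<le> M k\<close>, and the chosen index is one of them because
      \<open>real n \<le> M n\<close>.\<close>
    define H where "H y = h (nat \<lceil>f y\<rceil>) y" for y
    have H: "H y = h n y" if y: "y \<in> topspace X" "f y \<le> M n" for y n
    proof -
      have "f y \<le> M (nat \<lceil>f y\<rceil>)"
        using M[of "nat \<lceil>f y\<rceil>"] real_nat_ceiling_ge[of "f y"] by linarith
      then show ?thesis
        unfolding H_def using stable[of n "nat \<lceil>f y\<rceil>" y] stable[of "nat \<lceil>f y\<rceil>" n y] y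
        by (metis nle_le)
    qed
    have "continuous_map X euclideanreal H"
    proof (rule continuous_map_locally_eq)
      fix x assume x: "x \<in> topspace X"
      obtain n where n: "f x < real n" using reals_Archimedean2 by blast
      have "openin X {y \<in> topspace X. f y \<in> {..<real n}}"
        by (rule openin_continuous_map_preimage[OF f]) simp
      moreover have "\<forall>y\<in>{y \<in> topspace X. f y \<in> {..<real n}}. H y = h n y"
        using H M[of n] by force
      ultimately show "\<exists>U g. openin X U \<and> x \<in> U \<and> continuous_map X euclideanreal g \<and> (\<forall>y\<in>U. H y = g y)"
        using x n h[of n] by (intro exI[of _ "{y \<in> topspace X. f y \<in> {..<real n}}"] exI[of _ "h n"]) simp
    qed
    then obtain B where B: "\<forall>u\<in>A. \<bar>pairing u H\<bar> \<le> B"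
      using A by (auto simp: weakly_bounded_def)
    obtain n where n: "B < real n" "0 < n"
      using reals_Archimedean2[of "max B 0"] by (metis less_trans max_less_iff_conj of_nat_0_less_iff)
    have "pairing (u n) H = pairing (u n) (h n)"
    proof (rule pairing_cong)
      fix x assume x: "u n x \<noteq> 0"
      then have "x \<in> topspace X" using support_subset_topspace[of "u n" X x] u(1)[OF n(2)] AL by blast
      then show "H x = h n x" using H u(3)[OF n(2) x] by blast
    qed
    then show False using u(1,2)[OF n(2)] B n(1) by fastforce
  qed
  have "bounded (f ` {x. \<exists>u\<in>A. u x \<noteq> 0})" if f: "continuous_map X euclideanreal f" for f
  proof -
    have f': "continuous_map X euclideanreal (\<lambda>x. - f x)" using f by (rule continuous_map_minus)
    obtain M M' where M: "\<forall>u\<in>A. \<forall>x. u x \<noteq> 0 \<longrightarrow> f x \<le> M" "\<forall>u\<in>A. \<forall>x. u x \<noteq> 0 \<longrightarrow> - f x \<le> M'"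
      using bdd[OF f] bdd[OF f'] by blast
    have "\<bar>f x\<bar> \<le> max M M'" if "u \<in> A" "u x \<noteq> 0" for u x
      using M that by (smt (verit))
    then show ?thesis by (auto simp: bounded_iff)
  qed
  moreover have "{x. \<exists>u\<in>A. u x \<noteq> 0} \<subseteq> topspace X"
    using AL by (auto simp: Lcarrier_def)
  ultimately show ?thesis by (simp add: functionally_bounded_def)
qed

text \<open>Bumps at the support points, weighted by the signs of the coefficients, reproduce these
  signs on the support. Truncation to [-1,1] leaves the values there unchanged and supplies the
  uniform bound.\<close>

lemma l1_norming_function:
  assumes X: "completely_regular_space X" "Hausdorff_space X" and u: "u \<in> Lcarrier X"
  obtains g where "continuous_map X euclideanreal g" "\<And>y. \<bar>g y\<bar> \<le> 1"
    "pairing u g = (\<Sum>x | u x \<noteq> 0. \<bar>u x\<bar>)"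
proof -
  define F where "F = {x. u x \<noteq> 0}"
  have F: "finite F" "F \<subseteq> topspace X" using u by (auto simp: F_def Lcarrier_def)
  have "\<exists>g. continuous_map X euclideanreal g \<and> g x = 1 \<and> (\<forall>y\<in>F - {x}. g y = 0)" if "x \<in> F" for x
  proof -
    have "finite (F - {x})" "F - {x} \<subseteq> topspace X" "x \<in> topspace X" "x \<notin> F - {x}" using F that by auto
    from finite_bump[OF X this] show ?thesis by metis
  qed
  then obtain b where b: "\<And>x. x \<in> F \<Longrightarrow> continuous_map X euclideanreal (b x)"
    "\<And>x. x \<in> F \<Longrightarrow> b x x = (1::real)" "\<And>x y. x \<in> F \<Longrightarrow> y \<in> F - {x} \<Longrightarrow> b x y = 0"
    by metis
  define G where "G y = (\<Sum>x\<in>F. sgn (u x) * b x y)" for y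
  have G: "G y = sgn (u y)" if y: "y \<in> F" for y
  proof -
    have "G y = (\<Sum>x\<in>F. if x = y then sgn (u x) else 0)"
      unfolding G_def using b y by (intro sum.cong) auto
    then show ?thesis using F y by simp
  qed
  show ?thesis
  proof (rule that[of "\<lambda>y. max (-1) (min 1 (G y))"])
    show "continuous_map X euclideanreal (\<lambda>y. max (-1) (min 1 (G y)))"
      unfolding G_def using F b
      by (intro continuous_map_real_max continuous_map_real_min continuous_map_sum
          continuous_map_real_mult) auto
    show "\<And>y. \<bar>max (-1) (min 1 (G y))\<bar> \<le> 1" by auto
    show "pairing u (\<lambda>y. max (-1) (min 1 (G y))) = (\<Sum>x | u x \<noteq> 0. \<bar>u x\<bar>)"
      unfolding pairing_def using G by (intro sum.cong) (auto simp: F_def sgn_if)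
  qed
qed

lemma abs_pairing_le:
  assumes "\<And>x. u x \<noteq> 0 \<Longrightarrow> \<bar>f x\<bar> \<le> C"
  shows "\<bar>pairing u f\<bar> \<le> C * (\<Sum>x | u x \<noteq> 0. \<bar>u x\<bar>)"
proof -
  have "\<bar>pairing u f\<bar> \<le> (\<Sum>x | u x \<noteq> 0. \<bar>u x * f x\<bar>)"
    unfolding pairing_def by (rule sum_abs)
  also have "\<dots> \<le> (\<Sum>x | u x \<noteq> 0. C * \<bar>u x\<bar>)"
    using assms by (intro sum_mono) (auto simp: abs_mult mult.commute intro: mult_right_mono)
  finally show ?thesis by (simp add: sum_distrib_left)
qed

text \<open>Sokal's elementary proof of the uniform boundedness principle, carried out for the bounded
  continuous functions with the supremum norm.\<close>

lemma weakly_bounded_l1: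
  assumes X: "completely_regular_space X" "Hausdorff_space X"
    and A: "weakly_bounded X A"
  shows "\<exists>C. \<forall>u\<in>A. (\<Sum>x | u x \<noteq> 0. \<bar>u x\<bar>) \<le> C"
proof (rule ccontr)
  define l1 :: "('a \<Rightarrow> real) \<Rightarrow> real" where "l1 u = (\<Sum>x | u x \<noteq> 0. \<bar>u x\<bar>)" for u
  have AL: "A \<subseteq> Lcarrier X" using A by (simp add: weakly_bounded_def)
  assume "\<not> (\<exists>C. \<forall>u\<in>A. (\<Sum>x | u x \<noteq> 0. \<bar>u x\<bar>) \<le> C)"
  then have unbdd: "\<exists>u\<in>A. C < l1 u" for C unfolding l1_def by (meson not_le)
  \<comment> \<open>The correction at stage n has size \<open>(1/3) ^ n\<close> and makes the
    pairing with \<open>u\<close> at least \<open>(1/3) ^ n * l1 u\<close>. All later corrections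
    add up to at most \<open>(1/3) ^ n / 2\<close>, so at least half of that survives in the limit;
    the factor \<open>2 * real n * 3 ^ n\<close> makes this half at least n.\<close>
  define P where "P n s = (case s of (h, u) \<Rightarrow> continuous_map X euclideanreal h \<and>
      (0 < n \<longrightarrow> u \<in> A \<and> 2 * real n * 3 ^ n \<le> l1 u \<and> (1/3) ^ n * l1 u \<le> \<bar>pairing u h\<bar>))"
    for n :: nat and s :: "('a \<Rightarrow> real) \<times> ('a \<Rightarrow> real)"
  define Q where "Q n s s' = (\<forall>y\<in>topspace X. \<bar>fst s' y - fst s y\<bar> \<le> (1/3) ^ Suc n)"
    for n :: nat and s s' :: "('a \<Rightarrow> real) \<times> ('a \<Rightarrow> real)"
  have "\<exists>s. \<forall>n. P n (s n) \<and> Q n (s n) (s (Suc n))"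
  proof (rule dependent_nat_choice)
    show "\<exists>s. P 0 s" by (rule exI[of _ "(\<lambda>_. 0, \<lambda>_. 0)"]) (simp add: P_def)
    fix s n assume s: "P n s"
    define h where "h = fst s"
    have h: "continuous_map X euclideanreal h" using s by (auto simp: P_def h_def split: prod.splits)
    obtain u where u: "u \<in> A" "2 * real (Suc n) * 3 ^ Suc n < l1 u" using unbdd by blast
    obtain g where g: "continuous_map X euclideanreal g" "\<And>y. \<bar>g y\<bar> \<le> 1" "pairing u g = l1 u"
      using l1_norming_function[OF X, of u] u AL unfolding l1_def by blast
    define r :: real where "r = (1/3) ^ Suc n"
    have r: "0 < r" by (simp add: r_def)
    define h' where "h' t y = h y + t * g y" for t y
    have "pairing u (h' r) = pairing u h + r * l1 u" "pairing u (h' (-r)) = pairing u h - r * l1 u"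
      unfolding h'_def pairing_add_right pairing_scale_right g(3) by simp_all
    \<comment> \<open>The two pairings lie \<open>2 * r * l1 u\<close> apart, so they cannot both be
      closer to zero than \<open>r * l1 u\<close>.\<close>
    then have "r * l1 u \<le> \<bar>pairing u (h' r)\<bar> \<or> r * l1 u \<le> \<bar>pairing u (h' (-r))\<bar>" by linarith
    then obtain t where t: "\<bar>t\<bar> = r" "r * l1 u \<le> \<bar>pairing u (h' t)\<bar>"
      using r by (metis abs_minus_cancel abs_of_pos)
    have "continuous_map X euclideanreal (h' t)"
      unfolding h'_def using h g(1) by (intro continuous_map_add continuous_map_real_mult) auto
    moreover have "\<bar>h' t y - h y\<bar> \<le> r" for y
      using g(2)[of y] t(1) r mult_left_mono[OF g(2)[of y], of r] by (simp add: h'_def abs_mult)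
    ultimately have "P (Suc n) (h' t, u)" "Q n s (h' t, u)"
      using u t by (auto simp: P_def Q_def h_def r_def simp del: power_Suc of_nat_Suc)
    then show "\<exists>s'. P (Suc n) s' \<and> Q n s s'" by blast
  qed
  then obtain s where s: "\<And>n. P n (s n)" "\<And>n. Q n (s n) (s (Suc n))" by blast
  define h u where "h n = fst (s n)" and "u n = snd (s n)" for n
  have h: "continuous_map X euclideanreal (h n)"
    and u: "0 < n \<Longrightarrow> u n \<in> A" "0 < n \<Longrightarrow> 2 * real n * 3 ^ n \<le> l1 (u n)"
      "0 < n \<Longrightarrow> (1/3) ^ n * l1 (u n) \<le> \<bar>pairing (u n) (h n)\<bar>" for n
    using s(1)[of n] by (auto simp: P_def h_def u_def split: prod.splits)
  have hstep: "\<bar>h (Suc n) y - h n y\<bar> \<le> (1/3) ^ Suc n" if "y \<in> topspace X" for n y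
    using s(2)[of n] that by (simp add: Q_def h_def)
  \<comment> \<open>The exact geometric difference is carried along because the cruder bound
    \<open>(1/3) ^ n / 2\<close> does not reproduce itself in the induction.\<close>
  have tele: "\<bar>h k y - h n y\<bar> \<le> ((1/3) ^ n - (1/3) ^ k) / 2" if "n \<le> k" "y \<in> topspace X" for n k y
    using that(1)
  proof (induction k rule: dec_induct)
    case (step k)
    have "\<bar>h (Suc k) y - h n y\<bar> \<le> \<bar>h (Suc k) y - h k y\<bar> + \<bar>h k y - h n y\<bar>" by linarith
    also have "\<dots> \<le> (1/3) ^ Suc k + ((1/3) ^ n - (1/3) ^ k) / 2"
      by (intro add_mono hstep[OF that(2)] step.IH)
    also have "\<dots> = ((1/3) ^ n - (1/3) ^ Suc k) / 2" by (simp add: field_simps)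
    finally show ?case .
  qed simp
  have close: "\<bar>h k y - h n y\<bar> \<le> (1/3) ^ n / 2" if "n \<le> k" "y \<in> topspace X" for n k y
  proof -
    have "((1/3) ^ n - (1/3) ^ k) / 2 \<le> ((1/3) ^ n / 2 :: real)" by (simp add: divide_right_mono)
    with tele[OF that] show ?thesis by (rule order_trans)
  qed
  have "convergent (\<lambda>k. h k y)" if y: "y \<in> topspace X" for y
  proof (rule Cauchy_convergent, rule CauchyI)
    fix e :: real assume "0 < e"
    then obtain N where N: "(1/3) ^ N < e" using real_arch_pow_inv[of e "1/3"] by auto
    have "norm (h m y - h n y) < e" if "N \<le> m" "N \<le> n" for m n
    proof -
      have "norm (h m y - h n y) \<le> \<bar>h m y - h N y\<bar> + \<bar>h n y - h N y\<bar>"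
        unfolding real_norm_def by linarith
      also have "\<dots> \<le> (1/3) ^ N / 2 + (1/3) ^ N / 2" by (intro add_mono close that y)
      also have "\<dots> = (1/3) ^ N" by simp
      finally show ?thesis using N by (rule order_le_less_trans)
    qed
    then show "\<exists>M. \<forall>m\<ge>M. \<forall>n\<ge>M. norm (h m y - h n y) < e" by blast
  qed
  then obtain H where lim: "\<And>y. y \<in> topspace X \<Longrightarrow> (\<lambda>k. h k y) \<longlonglongrightarrow> H y"
    unfolding convergent_def by metis
  have H: "\<bar>H y - h n y\<bar> \<le> (1/3) ^ n / 2" if y: "y \<in> topspace X" for n y
  proof (rule tendsto_upperbound)
    show "(\<lambda>k. \<bar>h k y - h n y\<bar>) \<longlonglongrightarrow> \<bar>H y - h n y\<bar>" by (intro tendsto_intros lim y)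
    show "\<forall>\<^sub>F k in sequentially. \<bar>h k y - h n y\<bar> \<le> (1/3) ^ n / 2"
      using close y by (intro eventually_sequentiallyI[of n])
  qed simp
  have "continuous_map X Met_TC.mtopology H"
  proof (rule Met_TC.continuous_map_uniform_limit[where F = sequentially and f = h])
    fix e :: real assume e: "0 < e"
    then obtain N where N: "(1/3) ^ N < e" using real_arch_pow_inv[of e "1/3"] by auto
    show "\<forall>\<^sub>F n in sequentially. \<forall>x\<in>topspace X. H x \<in> UNIV \<and> dist (h n x) (H x) < e"
    proof (rule eventually_sequentiallyI[of N], intro ballI conjI)
      fix n x assume n: "N \<le> n" and x: "x \<in> topspace X"
      have "dist (h n x) (H x) = \<bar>H x - h n x\<bar>" by (simp add: dist_real_def abs_minus_commute)
      also have "\<dots> \<le> (1/3) ^ n / 2" by (rule H[OF x])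
      also have "\<dots> \<le> (1/3) ^ n" by simp
      also have "\<dots> \<le> (1/3) ^ N" using n by (intro power_decreasing) auto
      also note N
      finally show "dist (h n x) (H x) < e" .
    qed simp
  qed (use h in auto)
  then have "continuous_map X euclideanreal H" by simp
  then obtain B where B: "\<forall>u\<in>A. \<bar>pairing u H\<bar> \<le> B"
    using A by (auto simp: weakly_bounded_def)
  obtain n where n: "B < real n" "0 < n"
    using reals_Archimedean2[of "max B 0"] by (metis less_trans max_less_iff_conj of_nat_0_less_iff)
  define c where "c = (1/3) ^ n / 2 * l1 (u n)"
  have "\<bar>pairing (u n) (\<lambda>x. H x - h n x)\<bar> \<le> c"
    unfolding c_def l1_def
  proof (rule abs_pairing_le)
    fix x assume "u n x \<noteq> 0"
    then have "x \<in> topspace X" using support_subset_topspace[of "u n" X x] u(1)[OF n(2)] AL by blast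
    then show "\<bar>H x - h n x\<bar> \<le> (1/3) ^ n / 2" by (rule H)
  qed
  then have "\<bar>pairing (u n) H - pairing (u n) (h n)\<bar> \<le> c" by (simp only: pairing_diff_right)
  moreover have "c + c \<le> \<bar>pairing (u n) (h n)\<bar>"
    using u(3)[OF n(2)] by (simp add: c_def mult.commute)
  ultimately have "c \<le> \<bar>pairing (u n) H\<bar>" by linarith
  moreover have "real n \<le> c"
    unfolding c_def using mult_left_mono[OF u(2)[OF n(2)], of "(1/3) ^ n / 2"] by (simp add: power_divide)
  ultimately show False using B u(1)[OF n(2)] n(1) by fastforce
qed

text \<open>A separated sequence would carry a locally finite sum of bumps of growing height.\<close>

lemma functionally_bounded_net:
  assumes S: "functionally_bounded X S" and q: "admissible_seminorm X q" and e: "0 < e"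
  shows "\<exists>F. finite F \<and> F \<subseteq> S \<and> (\<forall>x\<in>S. \<exists>y\<in>F. q (\<lambda>z. dirac x z - dirac y z) < e)"
proof (rule ccontr)
  assume no_net: "\<not> ?thesis"
  note sq = admissible_seminormD(1)[OF q]
  define D where "D x y = q (\<lambda>z. dirac x z - dirac y z)" for x y
  have ST: "S \<subseteq> topspace X" using S by (simp add: functionally_bounded_def)
  have tri: "D x z \<le> D x y + D y z" if "x \<in> topspace X" "y \<in> topspace X" "z \<in> topspace X" for x y z
    unfolding D_def using that by (intro seminorm_diff_triangle[OF sq] dirac_in_Lcarrier)
  have comm: "D x y = D y x" if "x \<in> topspace X" "y \<in> topspace X" for x y
    unfolding D_def using that by (intro seminorm_diff_commute[OF sq] dirac_in_Lcarrier)
  have self: "D x x = 0" for x unfolding D_def by (rule seminorm_diff_self[OF sq])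
  have nonneg: "0 \<le> D x y" if "x \<in> topspace X" "y \<in> topspace X" for x y
    unfolding D_def using that by (intro seminorm_onD(1)[OF sq] Lcarrier_diff dirac_in_Lcarrier)
  have Dcont: "continuous_map X euclideanreal (\<lambda>y. D y x)" if x: "x \<in> topspace X" for x
  proof -
    have "continuous_map X Met_TC.mtopology (\<lambda>y. D y x)"
      unfolding Met_TC.continuous_map_to_metric
    proof (intro ballI allI impI)
      fix y and d :: real assume y: "y \<in> topspace X" and d: "0 < d"
      obtain U where U: "openin X U" "y \<in> U" "\<forall>w\<in>U. D w y < d"
        using admissible_seminormD(2)[OF q y d] unfolding D_def by blast
      have "D w x \<in> Met_TC.mball (D y x) d" if w: "w \<in> U" for w
      proof -
        have wT: "w \<in> topspace X" using w openin_subset[OF U(1)] by blast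
        have "\<bar>D y x - D w x\<bar> \<le> D w y"
          using tri[OF wT y x] tri[OF y wT x] comm[OF wT y] by linarith
        then show ?thesis using U(3) w by (auto simp: dist_real_def)
      qed
      then show "\<exists>U. openin X U \<and> y \<in> U \<and> (\<forall>w\<in>U. D w x \<in> Met_TC.mball (D y x) d)"
        using U by blast
    qed
    then show ?thesis by simp
  qed
  \<comment> \<open>The points are chosen greedily: no finite subset of S is a net, so some point of
    S has distance at least e from all earlier choices.\<close>
  have "\<exists>x::nat \<Rightarrow> 'a. \<forall>n. x n \<in> S \<and> (\<forall>m<n. e \<le> D (x n) (x m))"
  proof (rule dependent_wellorder_choice)
    fix n :: nat and f :: "nat \<Rightarrow> 'a"
    assume f: "\<And>m. m < n \<Longrightarrow> f m \<in> S \<and> (\<forall>l<m. e \<le> D (f m) (f l))"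
    then have "finite (f ` {..<n})" "f ` {..<n} \<subseteq> S" by auto
    then have "\<not> (\<forall>r\<in>S. \<exists>y\<in>f ` {..<n}. D r y < e)" using no_net unfolding D_def by blast
    then show "\<exists>r. r \<in> S \<and> (\<forall>m<n. e \<le> D r (f m))" by (auto simp: not_less)
  qed simp
  then obtain x :: "nat \<Rightarrow> 'a" where "\<forall>n. x n \<in> S \<and> (\<forall>m<n. e \<le> D (x n) (x m))" ..
  then have x: "x n \<in> S" and sep': "m < n \<Longrightarrow> e \<le> D (x n) (x m)" for m n by simp_all
  have xT: "x n \<in> topspace X" for n using x ST by blast
  have sep: "e \<le> D (x n) (x m)" if "m \<noteq> n" for m n
    using that sep'[of m n] sep'[of n m] comm[OF xT[of n] xT[of m]] by (cases m n rule: linorder_cases) simp_all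
  \<comment> \<open>Bumps of height n and radius \<open>e / 4\<close> around \<open>x n\<close>. The
    centres are e apart, so at most one index contributes to the sum at a given y.\<close>
  define h where "h y = (\<Sum>n | D y (x n) < e / 4. real n * max 0 (1 - 4 * D y (x n) / e))" for y
  have "continuous_map X euclideanreal h"
  proof (rule continuous_map_locally_eq)
    fix y assume y: "y \<in> topspace X"
    obtain U where U: "openin X U" "y \<in> U" "\<forall>w\<in>U. D w y < e / 4"
      using admissible_seminormD(2)[OF q y, of "e / 4"] e unfolding D_def by auto
    have UT: "U \<subseteq> topspace X" using openin_subset[OF U(1)] .
    define N where "N = {n. \<exists>w\<in>U. D w (x n) < e / 4}"
    \<comment> \<open>Two bumps meeting the same U would join their centres through w, y and v in
      four steps below \<open>e / 4\<close>; this dictates the radius.\<close>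
    have "n = m" if nm: "n \<in> N" "m \<in> N" for n m
    proof (rule ccontr)
      assume "n \<noteq> m"
      obtain w v where w: "w \<in> U" "D w (x n) < e / 4" and v: "v \<in> U" "D v (x m) < e / 4"
        using nm unfolding N_def by blast
      have wT: "w \<in> topspace X" "v \<in> topspace X" using w v UT by auto
      have "D (x n) (x m) \<le> D (x n) w + D w y + D y v + D v (x m)"
        using tri[OF xT wT(1) xT, of n m] tri[OF wT(1) y xT, of m] tri[OF y wT(2) xT, of m] by linarith
      moreover have "D (x n) w < e / 4" "D w y < e / 4" "D y v < e / 4"
        using w v U comm[OF xT wT(1), of n] comm[OF y wT(2)] by auto
      ultimately have "D (x n) (x m) < e" using v by linarith
      then show False using sep[of m n] \<open>n \<noteq> m\<close> by simp
    qed
    then have "N \<subseteq> {SOME n. n \<in> N}" by (metis singletonI someI subsetI)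
    then have "finite N" by (rule finite_subset) simp
    have "continuous_map X euclideanreal (\<lambda>w. \<Sum>n\<in>N. real n * max 0 (1 - 4 * D w (x n) / e))"
      using \<open>finite N\<close> e
      by (intro continuous_map_sum continuous_map_real_mult continuous_map_real_max continuous_map_diff
          continuous_map_real_divide Dcont xT) auto
    moreover have "h w = (\<Sum>n\<in>N. real n * max 0 (1 - 4 * D w (x n) / e))" if w: "w \<in> U" for w
      unfolding h_def
    proof (rule sum.mono_neutral_left[OF \<open>finite N\<close>])
      show "{n. D w (x n) < e / 4} \<subseteq> N" using w by (auto simp: N_def)
      show "\<forall>n\<in>N - {n. D w (x n) < e / 4}. real n * max 0 (1 - 4 * D w (x n) / e) = 0"
        using e by (auto simp: field_simps max_def)
    qed
    ultimately show "\<exists>U g. openin X U \<and> y \<in> U \<and> continuous_map X euclideanreal g \<and> (\<forall>w\<in>U. h w = g w)"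
      using U by blast
  qed
  then have "bounded (h ` S)" using S by (simp add: functionally_bounded_def)
  then obtain B where B: "\<forall>y\<in>S. \<bar>h y\<bar> \<le> B" by (auto simp: bounded_iff)
  have "h (x n) = real n" for n
  proof -
    have "{m. D (x n) (x m) < e / 4} = {n}"
    proof (intro equalityI subsetI)
      fix m assume "m \<in> {m. D (x n) (x m) < e / 4}"
      then show "m \<in> {n}" using sep[of m n] e by force
    qed (use self e in simp)
    then show ?thesis by (simp add: h_def self)
  qed
  then have "real n \<le> B" for n using B x[of n] by force
  then show False using reals_Archimedean2[of B] by (meson not_le)
qed

section \<open>Coarse limited sets\<close>

text \<open>The unit ball of the seminorm given by f is a neighbourhood of zero, and a factor t that
  shrinks A into it bounds all pairings by \<open>1 / t\<close>.\<close>

lemma lc_bounded_imp_weakly_bounded: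
  assumes A: "lc_bounded X A"
  shows "weakly_bounded X A"
  unfolding weakly_bounded_def
proof (intro conjI allI impI)
  show "A \<subseteq> Lcarrier X" using A by (simp add: lc_bounded_def)
  fix f assume f: "continuous_map X euclideanreal f"
  define U where "U = {v \<in> Lcarrier X. \<bar>pairing (\<lambda>x. v x - 0) f\<bar> < 1}"
  have "openin (free_lc_topology X) U"
    unfolding U_def
    by (rule openin_free_lc_ball[OF admissible_seminorm_pairing[OF f] zero_in_Lcarrier])
  moreover have "(\<lambda>x. 0) \<in> U" by (simp add: U_def pairing_def)
  ultimately obtain t where t: "0 < t" "(\<lambda>u x. t * u x) ` A \<subseteq> U"
    using A by (auto simp: lc_bounded_def)
  have "\<bar>pairing u f\<bar> \<le> 1 / t" if "u \<in> A" for u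
  proof -
    have "(\<lambda>x. t * u x) \<in> U" using t that by blast
    then have "t * \<bar>pairing u f\<bar> < 1" using t by (simp add: U_def pairing_scale_left abs_mult)
    then show ?thesis using t by (simp add: field_simps)
  qed
  then show "\<exists>B. \<forall>u\<in>A. \<bar>pairing u f\<bar> \<le> B" by blast
qed

text \<open>The balls of radius e about the elements of the compact box cover it; the centres of a
  finite subcover form the net.\<close>

lemma finite_dimensional_box_net:
  assumes F: "finite F" "F \<subseteq> topspace X" and C: "0 \<le> C"
    and q: "admissible_seminorm X q" and e: "0 < e"
  obtains W where "finite W" "W \<subseteq> Lcarrier X"
    "\<And>u. {x. u x \<noteq> 0} \<subseteq> F \<Longrightarrow> (\<And>x. \<bar>u x\<bar> \<le> C) \<Longrightarrow> \<exists>w\<in>W. q (\<lambda>x. u x - w x) < e"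
proof -
  define K where "K = {u. {x. u x \<noteq> 0} \<subseteq> F \<and> (\<forall>x. \<bar>u x\<bar> \<le> C)}"
  define O' where "O' w = {v \<in> Lcarrier X. q (\<lambda>x. v x - w x) < e}" for w
  have K: "compactin (free_lc_topology X) K"
    unfolding K_def by (rule compactin_finite_dimensional_box[OF F C])
  have KL: "K \<subseteq> Lcarrier X" using compactin_subset_topspace[OF K] by simp
  have "openin (free_lc_topology X) (O' w)" if "w \<in> K" for w
    unfolding O'_def using that KL by (intro openin_free_lc_ball[OF q]) blast
  moreover have "w \<in> O' w" if "w \<in> K" for w
    using that KL e seminorm_diff_self[OF admissible_seminormD(1)[OF q], of w] by (auto simp: O'_def)
  ultimately obtain \<F> where \<F>: "finite \<F>" "\<F> \<subseteq> O' ` K" "K \<subseteq> \<Union>\<F>"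
    using compactinD[OF K, of "O' ` K"] by blast
  then obtain W where W: "W \<subseteq> K" "finite W" "\<F> = O' ` W"
    by (meson finite_subset_image)
  show ?thesis
  proof (rule that[of W])
    fix u assume "{x. u x \<noteq> 0} \<subseteq> F" "\<And>x. \<bar>u x\<bar> \<le> C"
    then have "u \<in> \<Union>\<F>" using \<F>(3) by (auto simp: K_def)
    then show "\<exists>w\<in>W. q (\<lambda>x. u x - w x) < e" using W by (auto simp: O'_def)
  qed (use W KL in auto)
qed

lemma abs_le_l1:
  assumes "u \<in> Lcarrier X"
  shows "\<bar>u x\<bar> \<le> (\<Sum>x | u x \<noteq> 0. \<bar>u x\<bar>)"
proof (cases "u x = 0")
  case False
  then show ?thesis
    using member_le_sum[of x "{x. u x \<noteq> 0}" "\<lambda>x. \<bar>u x\<bar>"] finite_support[OF assms] by auto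
qed (simp add: sum_nonneg)

text \<open>Moving every support point to the nearest point of a finite net of the supports changes an
  element by little and puts it into a finite-dimensional box.\<close>

lemma weakly_bounded_net:
  assumes X: "completely_regular_space X" "Hausdorff_space X"
    and A: "weakly_bounded X A" and q: "admissible_seminorm X q" and e: "0 < e"
  obtains W where "finite W" "W \<subseteq> A" "\<And>u. u \<in> A \<Longrightarrow> \<exists>w\<in>W. q (\<lambda>x. u x - w x) < e"
proof -
  note sq = admissible_seminormD(1)[OF q]
  have AL: "A \<subseteq> Lcarrier X" using A by (simp add: weakly_bounded_def)
  define S where "S = {x. \<exists>u\<in>A. u x \<noteq> 0}"
  have S: "functionally_bounded X S" unfolding S_def by (rule weakly_bounded_support[OF X A])
  then have ST: "S \<subseteq> topspace X" by (simp add: functionally_bounded_def)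
  obtain C0 where C0: "\<forall>u\<in>A. (\<Sum>x | u x \<noteq> 0. \<bar>u x\<bar>) \<le> C0" using weakly_bounded_l1[OF X A] by blast
  \<comment> \<open>For empty A the bound \<open>C0\<close> may be negative, whereas the box needs
    \<open>0 \<le> C\<close>.\<close>
  define C where "C = max C0 0"
  have C: "0 \<le> C" "\<And>u. u \<in> A \<Longrightarrow> (\<Sum>x | u x \<noteq> 0. \<bar>u x\<bar>) \<le> C" using C0 by (force simp: C_def)+
  \<comment> \<open>Moving the support points costs at most \<open>C * d\<close>, which has to stay
    within \<open>e / 4\<close>; the \<open>+ 1\<close> covers \<open>C = 0\<close>.\<close>
  define d where "d = e / (4 * (C + 1))"
  have d: "0 < d" using e C by (simp add: d_def)
  have Cd: "C * d \<le> e / 4" using e C by (simp add: d_def field_simps)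
  obtain F where F: "finite F" "F \<subseteq> S" "\<forall>x\<in>S. \<exists>y\<in>F. q (\<lambda>z. dirac x z - dirac y z) < d"
    using functionally_bounded_net[OF S q d] by blast
  have FT: "F \<subseteq> topspace X" using F ST by blast
  obtain \<pi> where \<pi>: "\<And>x. x \<in> S \<Longrightarrow> \<pi> x \<in> F"
    "\<And>x. x \<in> S \<Longrightarrow> q (\<lambda>z. dirac x z - dirac (\<pi> x) z) < d"
    using F(3) by metis
  have e4: "0 < e / 4" using e by simp
  obtain W0 where W0: "finite W0" "W0 \<subseteq> Lcarrier X"
    "\<And>u. {x. u x \<noteq> 0} \<subseteq> F \<Longrightarrow> (\<And>x. \<bar>u x\<bar> \<le> C) \<Longrightarrow> \<exists>w\<in>W0. q (\<lambda>x. u x - w x) < e / 4"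
    using finite_dimensional_box_net[OF F(1) FT C(1) q e4] by blast
  have near: "\<exists>w\<in>W0. q (\<lambda>x. u x - w x) < e / 2" if u: "u \<in> A" for u
  proof -
    have uL: "u \<in> Lcarrier X" using u AL by blast
    define G where "G = {x. u x \<noteq> 0}"
    have G: "finite G" "G \<subseteq> S" "G \<subseteq> topspace X"
      using uL u by (auto simp: G_def S_def Lcarrier_def)
    \<comment> \<open>The image of u when every support point x moves to \<open>\<pi> x\<close>.
      Points may collapse, so coefficients of \<open>k\<close> are sums of coefficients of u, still
      bounded by the l1-norm.\<close>
    define k where "k z = (\<Sum>x\<in>G. u x * dirac (\<pi> x) z)" for z
    have d\<pi>: "dirac (\<pi> x) \<in> Lcarrier X" if "x \<in> G" for x
      using that G \<pi>(1)[of x] FT by (intro dirac_in_Lcarrier) blast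
    have dx: "dirac x \<in> Lcarrier X" if "x \<in> G" for x
      using that G by (intro dirac_in_Lcarrier) blast
    have kL: "k \<in> Lcarrier X" unfolding k_def using G d\<pi> by (intro Lcarrier_sum) auto
    have "k z = 0" if "z \<notin> F" for z
      unfolding k_def using that \<pi>(1) G by (intro sum.neutral) (auto simp: dirac_def)
    then have k1: "{z. k z \<noteq> 0} \<subseteq> F" by blast
    have k2: "\<bar>k z\<bar> \<le> C" for z
    proof -
      have "\<bar>k z\<bar> \<le> (\<Sum>x\<in>G. \<bar>u x * dirac (\<pi> x) z\<bar>)" unfolding k_def by (rule sum_abs)
      also have "\<dots> \<le> (\<Sum>x\<in>G. \<bar>u x\<bar>)" by (intro sum_mono) (auto simp: dirac_def)
      also have "\<dots> \<le> C" unfolding G_def by (rule C(2)[OF u])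
      finally show ?thesis .
    qed
    have "u z - k z = (\<Sum>x\<in>G. u x * (dirac x z - dirac (\<pi> x) z))" for z
      using fun_cong[OF dirac_expansion[OF G(1), of u], of z]
      by (simp add: G_def k_def sum_subtractf algebra_simps)
    then have "q (\<lambda>z. u z - k z) = q (\<lambda>z. \<Sum>x\<in>G. u x * (dirac x z - dirac (\<pi> x) z))" by simp
    also have "\<dots> \<le> (\<Sum>x\<in>G. \<bar>u x\<bar> * q (\<lambda>z. dirac x z - dirac (\<pi> x) z))"
      using seminorm_Lcarrier_sum[OF sq G(1), of "\<lambda>x z. dirac x z - dirac (\<pi> x) z" u] dx d\<pi>
      by (auto intro: Lcarrier_diff)
    also have "\<dots> \<le> (\<Sum>x\<in>G. \<bar>u x\<bar> * d)"
    proof (intro sum_mono mult_left_mono)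
      fix x assume "x \<in> G"
      then show "q (\<lambda>z. dirac x z - dirac (\<pi> x) z) \<le> d" using \<pi>(2)[of x] G(2) by auto
    qed simp
    also have "\<dots> = (\<Sum>x\<in>G. \<bar>u x\<bar>) * d" by (simp add: sum_distrib_right)
    also have "\<dots> \<le> C * d" using C(2)[OF u] d by (intro mult_right_mono) (auto simp: G_def)
    also note Cd
    finally have uk: "q (\<lambda>z. u z - k z) \<le> e / 4" .
    obtain w where w: "w \<in> W0" "q (\<lambda>x. k x - w x) < e / 4" using W0(3)[OF k1 k2] by blast
    have wL: "w \<in> Lcarrier X" using w W0 by blast
    have "q (\<lambda>x. u x - w x) \<le> q (\<lambda>z. u z - k z) + q (\<lambda>x. k x - w x)"
      by (rule seminorm_diff_triangle[OF sq uL kL wL])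
    also have "\<dots> < e / 4 + e / 4" using uk w(2) by (rule add_le_less_mono)
    finally show ?thesis using w(1) by (intro bexI[of _ w]) auto
  qed
  \<comment> \<open>The elements of \<open>W0\<close> need not belong to A. Each one near A is
    exchanged for an element of A, which doubles the radius from \<open>e / 2\<close> to e.\<close>
  define W1 where "W1 = {w \<in> W0. \<exists>u\<in>A. q (\<lambda>x. u x - w x) < e / 2}"
  obtain r where r: "\<And>w. w \<in> W1 \<Longrightarrow> r w \<in> A \<and> q (\<lambda>x. r w x - w x) < e / 2"
  proof -
    have "\<forall>w\<in>W1. \<exists>u. u \<in> A \<and> q (\<lambda>x. u x - w x) < e / 2" unfolding W1_def by blast
    from bchoice[OF this] show thesis using that by blast
  qed
  show ?thesis
  proof (rule that[of "r ` W1"])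
    show "finite (r ` W1)" using W0 by (simp add: W1_def)
    show "r ` W1 \<subseteq> A" using r by blast
    fix u assume u: "u \<in> A"
    obtain w where w: "w \<in> W0" "q (\<lambda>x. u x - w x) < e / 2" using near[OF u] by blast
    have w1: "w \<in> W1" using w u by (auto simp: W1_def)
    have L: "u \<in> Lcarrier X" "w \<in> Lcarrier X" "r w \<in> Lcarrier X" using u w W0 r[OF w1] AL by auto
    have "q (\<lambda>x. u x - r w x) \<le> q (\<lambda>x. u x - w x) + q (\<lambda>x. w x - r w x)"
      by (rule seminorm_diff_triangle[OF sq L])
    also have "q (\<lambda>x. w x - r w x) = q (\<lambda>x. r w x - w x)"
      by (rule seminorm_diff_commute[OF sq L(2,3)])
    also have "q (\<lambda>x. u x - w x) + \<dots> < e / 2 + e / 2"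
      using w(2) r[OF w1] by (intro add_strict_mono) auto
    finally show "\<exists>w\<in>r ` W1. q (\<lambda>x. u x - w x) < e" using w1 by auto
  qed
qed

lemma weakly_bounded_imp_coarse_p_limited:
  assumes p: "1 \<le> p" and X: "completely_regular_space X" "Hausdorff_space X"
    and A: "weakly_bounded X A"
  shows "coarse_p_limited p X A"
  unfolding coarse_p_limited_def
proof (intro conjI allI impI)
  show AL: "A \<subseteq> Lcarrier X" using A by (simp add: weakly_bounded_def)
  fix T assume "linear_on (Lcarrier X) T \<and> continuous_map (free_lc_topology X) (lp_topology p) T"
  then have T: "linear_on (Lcarrier X) T" "continuous_map (free_lc_topology X) (lp_topology p) T"
    by auto
  note T' = admissible_seminorm_lp_operator[OF p T]
  have TA: "T ` A \<subseteq> lp_space p" using T'(2) AL by blast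
  show "relatively_compact_in (lp_topology p) (T ` A)"
    unfolding relatively_compact_lp_iff[OF p TA]
  proof (intro allI impI)
    fix e :: real assume e: "0 < e"
    obtain W where W: "finite W" "W \<subseteq> A"
      "\<And>u. u \<in> A \<Longrightarrow> \<exists>w\<in>W. lp_norm p (T (\<lambda>x. u x - w x)) < e"
      using weakly_bounded_net[OF X A T'(1) e] by blast
    have "\<exists>b\<in>T ` W. lp_norm p (\<lambda>n. a n - b n) < e" if a: "a \<in> T ` A" for a
    proof -
      obtain u where u: "u \<in> A" "a = T u" using a by blast
      obtain w where w: "w \<in> W" "lp_norm p (T (\<lambda>x. u x - w x)) < e" using W(3)[OF u(1)] by blast
      have "T (\<lambda>x. u x - w x) = (\<lambda>n. T u n - T w n)" using u w W AL by (intro T'(3)) auto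
      then show ?thesis using w u by auto
    qed
    then show "\<exists>K. finite K \<and> K \<subseteq> T ` A \<and> (\<forall>a\<in>T ` A. \<exists>b\<in>K. lp_norm p (\<lambda>n. a n - b n) < e)"
      using W by (intro exI[of _ "T ` W"]) auto
  qed
qed

section \<open>Rank-one test operators\<close>

lemma unit_sequence_in_lp: "(\<lambda>n. if n = 0 then 1 else 0) \<in> lp_space p"
proof -
  have "(\<lambda>n::nat. if n = 0 then 1 else 0 :: real) \<longlonglongrightarrow> 0"
    by (rule tendsto_eventually) (auto intro!: eventually_sequentiallyI[of 1])
  moreover have "summable (\<lambda>n::nat. \<bar>if n = 0 then 1 else 0 :: real\<bar> powr r)" for r
    by (rule summable_finite[of "{0}"]) auto
  ultimately show ?thesis by (simp add: lp_space_def)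
qed

text \<open>The operator sending u to \<open>pairing u f\<close> times the first unit sequence is
  continuous, as \<open>\<bar>pairing u f\<bar>\<close> is admissible. Relative compactness of the
  image bounds its coordinate 0, which is the pairing itself.\<close>

lemma coarse_p_limited_imp_weakly_bounded:
  assumes p: "1 \<le> p" and A: "coarse_p_limited p X A"
  shows "weakly_bounded X A"
  unfolding weakly_bounded_def
proof (intro conjI allI impI)
  show AL: "A \<subseteq> Lcarrier X" using A by (simp add: coarse_p_limited_def)
  fix f assume f: "continuous_map X euclideanreal f"
  define i :: "nat \<Rightarrow> real" where "i n = (if n = 0 then 1 else 0)" for n
  have i: "i \<in> lp_space p" unfolding i_def by (rule unit_sequence_in_lp)
  define T where "T u = (\<lambda>n. pairing u f * i n)" for u
  have Tlp: "T u \<in> lp_space p" for u unfolding T_def by (rule lp_scale(1)[OF p i])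
  have lin: "linear_on (Lcarrier X) T"
    unfolding linear_on_def T_def by (auto simp: pairing_add_left pairing_scale_left algebra_simps)
  have cont: "continuous_map (free_lc_topology X) (lp_topology p) T"
    unfolding continuous_map_def
  proof (intro conjI allI impI)
    show "T \<in> topspace (free_lc_topology X) \<rightarrow> topspace (lp_topology p)"
      using Tlp by (simp add: topspace_lp_topology[OF p])
    fix V assume V: "openin (lp_topology p) V"
    show "openin (free_lc_topology X) {u \<in> topspace (free_lc_topology X). T u \<in> V}"
      unfolding openin_free_lc_topology
    proof (intro conjI ballI)
      fix u assume "u \<in> {u \<in> topspace (free_lc_topology X). T u \<in> V}"
      then have u: "u \<in> Lcarrier X" "T u \<in> V" by auto
      obtain e where e: "0 < e" "{b \<in> lp_space p. lp_norm p (\<lambda>n. b n - T u n) < e} \<subseteq> V"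
        using V u(2) unfolding openin_lp_topology[OF p] by blast
      have N: "0 \<le> lp_norm p i" by (rule lp_norm_nonneg[OF p i])
      define d where "d = e / (lp_norm p i + 1)"
      have d: "0 < d" using e N by (simp add: d_def)
      have "T v \<in> V" if v: "v \<in> Lcarrier X" "\<bar>pairing (\<lambda>x. v x - u x) f\<bar> < d" for v
      proof -
        have "(\<lambda>n. T v n - T u n) = (\<lambda>n. pairing (\<lambda>x. v x - u x) f * i n)"
          by (simp add: T_def pairing_diff_left[OF v(1) u(1)] algebra_simps)
        then have "lp_norm p (\<lambda>n. T v n - T u n) = \<bar>pairing (\<lambda>x. v x - u x) f\<bar> * lp_norm p i"
          using lp_scale(2)[OF p i] by simp
        also have "\<dots> \<le> d * lp_norm p i" using v(2) N by (intro mult_right_mono) auto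
        also have "\<dots> < e" using e N by (simp add: d_def field_simps)
        finally show ?thesis using e(2) Tlp by blast
      qed
      then have "{v \<in> Lcarrier X. \<bar>pairing (\<lambda>x. v x - u x) f\<bar> < d}
          \<subseteq> {u \<in> topspace (free_lc_topology X). T u \<in> V}" by auto
      then show "\<exists>q d. admissible_seminorm X q \<and> d > 0 \<and>
          {v \<in> Lcarrier X. q (\<lambda>x. v x - u x) < d} \<subseteq> {u \<in> topspace (free_lc_topology X). T u \<in> V}"
        using admissible_seminorm_pairing[OF f] d
        by (intro exI[of _ "\<lambda>u. \<bar>pairing u f\<bar>"] exI[of _ d]) blast
    qed simp
  qed
  have TA: "T ` A \<subseteq> lp_space p" using Tlp by blast
  have "relatively_compact_in (lp_topology p) (T ` A)"
    using A lin cont by (simp add: coarse_p_limited_def)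
  from this[unfolded relatively_compact_lp_iff[OF p TA], rule_format, OF zero_less_one]
  obtain K where K: "finite K" "K \<subseteq> T ` A" "\<forall>a\<in>T ` A. \<exists>b\<in>K. lp_norm p (\<lambda>n. a n - b n) < 1"
    by blast
  \<comment> \<open>The sum over the finite 1-net is a crude substitute for the maximum of
    \<open>\<bar>b 0\<bar>\<close>.\<close>
  have "\<bar>pairing u f\<bar> \<le> 1 + (\<Sum>b\<in>K. \<bar>b 0\<bar>)" if u: "u \<in> A" for u
  proof -
    obtain b where b: "b \<in> K" "lp_norm p (\<lambda>n. T u n - b n) < 1" using K(3) u by blast
    have "b \<in> lp_space p" using b K TA by blast
    then have "\<bar>T u 0 - b 0\<bar> \<le> lp_norm p (\<lambda>n. T u n - b n)"
      using abs_le_lp_norm[OF p lp_diff[OF p Tlp], of b u 0] by simp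
    moreover have "T u 0 = pairing u f" by (simp add: T_def i_def)
    moreover have "\<bar>b 0\<bar> \<le> (\<Sum>b\<in>K. \<bar>b 0\<bar>)"
      using member_le_sum[of b K "\<lambda>b. \<bar>b 0\<bar>"] b K by auto
    ultimately show ?thesis using b(2) by linarith
  qed
  then show "\<exists>B. \<forall>u\<in>A. \<bar>pairing u f\<bar> \<le> B" by blast
qed

section \<open>The coarse GP property\<close>

lemma coarse_GP_if_functionally_bounded_finite:
  assumes p: "1 \<le> p" and X: "completely_regular_space X" "Hausdorff_space X"
    and fin: "\<And>S. functionally_bounded X S \<Longrightarrow> finite S"
  shows "coarse_GP p X"
  unfolding coarse_GP_def
proof (intro allI impI)
  fix A assume "coarse_p_limited p X A"
  then have A: "weakly_bounded X A" by (rule coarse_p_limited_imp_weakly_bounded[OF p])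
  then have AL: "A \<subseteq> Lcarrier X" by (simp add: weakly_bounded_def)
  define F where "F = {x. \<exists>u\<in>A. u x \<noteq> 0}"
  have F: "functionally_bounded X F" unfolding F_def by (rule weakly_bounded_support[OF X A])
  obtain C0 where C0: "\<forall>u\<in>A. (\<Sum>x | u x \<noteq> 0. \<bar>u x\<bar>) \<le> C0" using weakly_bounded_l1[OF X A] by blast
  define C where "C = max C0 0"
  define K where "K = {u. {x. u x \<noteq> 0} \<subseteq> F \<and> (\<forall>x. \<bar>u x\<bar> \<le> C)}"
  have K: "compactin (free_lc_topology X) K"
    unfolding K_def using F fin[OF F]
    by (intro compactin_finite_dimensional_box) (auto simp: functionally_bounded_def C_def)
  have "\<bar>u x\<bar> \<le> C" if u: "u \<in> A" for u x
  proof -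
    have "\<bar>u x\<bar> \<le> (\<Sum>x | u x \<noteq> 0. \<bar>u x\<bar>)" using u AL by (intro abs_le_l1[of u X]) blast
    also have "\<dots> \<le> C" using C0 u by (force simp: C_def)
    finally show ?thesis .
  qed
  then have "A \<subseteq> K" by (auto simp: K_def F_def)
  \<comment> \<open>The compact box is closed because L(X) is Hausdorff, so it contains the closure
    as well.\<close>
  then have "free_lc_topology X closure_of A \<subseteq> K"
    using compactin_imp_closedin[OF Hausdorff_free_lc_topology[OF X] K] by (rule closure_of_minimal)
  then show "relatively_compact_in (free_lc_topology X) A"
    unfolding relatively_compact_in_def using closed_compactin[OF K _ closedin_closure_of] by blast
qed

lemma functionally_bounded_finite_if_coarse_GP:
  assumes p: "1 \<le> p" and X: "completely_regular_space X" "Hausdorff_space X"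
    and GP: "coarse_GP p X" and S: "functionally_bounded X S"
  shows "finite S"
proof (rule ccontr)
  assume "infinite S"
  then obtain x :: "nat \<Rightarrow> 'a" where x: "inj x" "range x \<subseteq> S" using infinite_countable_subset by blast
  have xT: "x n \<in> topspace X" for n using x S by (auto simp: functionally_bounded_def)
  define u where "u N = (\<lambda>z. \<Sum>n<N. (1/2) ^ n * dirac (x n) z)" for N :: nat
  have uL: "u N \<in> Lcarrier X" for N
    unfolding u_def using xT by (intro Lcarrier_sum dirac_in_Lcarrier) auto
  have pair: "pairing (u N) f = (\<Sum>n<N. (1/2) ^ n * f (x n))" for N f
    unfolding u_def using pairing_sum_left[of "{..<N}" "\<lambda>n. dirac (x n)" X "\<lambda>n. (1/2) ^ n" f] xT
    by (simp add: pairing_dirac dirac_in_Lcarrier)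
  have "weakly_bounded X (range u)"
    unfolding weakly_bounded_def
  proof (intro conjI allI impI)
    show "range u \<subseteq> Lcarrier X" using uL by blast
    fix f assume "continuous_map X euclideanreal f"
    then have "bounded (f ` S)" using S by (simp add: functionally_bounded_def)
    then obtain B where B: "\<And>y. y \<in> S \<Longrightarrow> \<bar>f y\<bar> \<le> B" by (auto simp: bounded_iff)
    have fB: "\<bar>f (x n)\<bar> \<le> B" for n using B x by blast
    have B0: "0 \<le> B" using fB[of 0] by linarith
    have "\<bar>pairing (u N) f\<bar> \<le> 2 * B" for N
    proof -
      have "\<bar>pairing (u N) f\<bar> \<le> (\<Sum>n<N. \<bar>(1/2) ^ n * f (x n)\<bar>)" unfolding pair by (rule sum_abs)
      also have "\<dots> \<le> (\<Sum>n<N. (1/2) ^ n * B)"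
        using fB by (intro sum_mono) (auto simp: abs_mult intro!: mult_left_mono)
      also have "\<dots> = (\<Sum>n<N. (1/2) ^ n) * B" by (simp add: sum_distrib_right)
      also have "\<dots> \<le> 2 * B"
      proof (rule mult_right_mono[OF _ B0])
        have "(\<Sum>n<N. (1/2) ^ n) + 2 * (1/2) ^ N = (2 :: real)" by (induction N) auto
        moreover have "(0 :: real) \<le> 2 * (1/2) ^ N" by simp
        ultimately show "(\<Sum>n<N. (1/2) ^ n) \<le> (2 :: real)" by linarith
      qed
      finally show ?thesis .
    qed
    then show "\<exists>B. \<forall>v\<in>range u. \<bar>pairing v f\<bar> \<le> B" by blast
  qed
  then have "coarse_p_limited p X (range u)" by (rule weakly_bounded_imp_coarse_p_limited[OF p X])
  then have K: "compactin (free_lc_topology X) (free_lc_topology X closure_of range u)"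
    using GP by (simp add: coarse_GP_def relatively_compact_in_def)
  \<comment> \<open>No v is an accumulation point: its finite support misses some
    \<open>x n\<close>, and a nonnegative bump g at \<open>x n\<close> that vanishes on the support
    of v pairs to 0 with v but to at least \<open>(1/2) ^ n\<close> with every \<open>u N\<close>
    for \<open>N > n\<close>.\<close>
  have "\<exists>V. openin (free_lc_topology X) V \<and> v \<in> V \<and> finite {N. u N \<in> V}" if v: "v \<in> Lcarrier X" for v
  proof -
    have "infinite (range x)" using x(1) by (simp add: finite_image_iff)
    then obtain n where n: "v (x n) = 0"
      using finite_subset[OF _ finite_support[OF v], of "range x"] by blast
    have sv: "{y. v y \<noteq> 0} \<subseteq> topspace X" "x n \<notin> {y. v y \<noteq> 0}" using v n by (auto simp: Lcarrier_def)
    obtain g where g: "continuous_map X euclideanreal g" "g (x n) = 1"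
      "\<And>y. y \<in> {y. v y \<noteq> 0} \<Longrightarrow> g y = 0" "\<And>y. y \<in> topspace X \<Longrightarrow> 0 \<le> g y"
      using finite_bump[OF X finite_support[OF v] sv(1) xT[of n] sv(2)] by metis
    have vg: "pairing v g = 0" unfolding pairing_def using g(3) by (intro sum.neutral) simp
    define V where "V = {w \<in> Lcarrier X. \<bar>pairing (\<lambda>z. w z - v z) g\<bar> < (1/2) ^ n}"
    have "openin (free_lc_topology X) V"
      unfolding V_def by (rule openin_free_lc_ball[OF admissible_seminorm_pairing[OF g(1)] v])
    moreover have "v \<in> V" using v by (simp add: V_def pairing_def)
    moreover have "{N. u N \<in> V} \<subseteq> {..n}"
    proof
      fix N assume "N \<in> {N. u N \<in> V}"
      then have lt: "\<bar>pairing (u N) g\<bar> < (1/2) ^ n"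
        using pairing_diff_left[OF uL v, of N g] vg by (simp add: V_def)
      show "N \<in> {..n}"
      proof (rule ccontr)
        assume "N \<notin> {..n}"
        \<comment> \<open>As g is nonnegative, the other terms cannot cancel the one at
          \<open>x n\<close>, which occurs in the sum once \<open>N > n\<close>.\<close>
        then have "(1/2) ^ n * g (x n) \<le> (\<Sum>n<N. (1/2) ^ n * g (x n))"
          using g(4) xT by (intro member_le_sum) auto
        then show False using lt g(2) unfolding pair by simp
      qed
    qed
    ultimately show ?thesis using finite_subset by blast
  qed
  then obtain V where V: "\<And>v. v \<in> Lcarrier X \<Longrightarrow> openin (free_lc_topology X) (V v)"
    "\<And>v. v \<in> Lcarrier X \<Longrightarrow> v \<in> V v" "\<And>v. v \<in> Lcarrier X \<Longrightarrow> finite {N. u N \<in> V v}"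
    by metis
  define C where "C = free_lc_topology X closure_of range u"
  have CL: "C \<subseteq> Lcarrier X" unfolding C_def using closure_of_subset_topspace[of "free_lc_topology X"] by simp
  have "\<And>U. U \<in> V ` C \<Longrightarrow> openin (free_lc_topology X) U" "C \<subseteq> \<Union>(V ` C)"
    using V(1,2) CL by auto
  from compactinD[OF K[folded C_def] this]
  obtain \<F> where \<F>: "finite \<F>" "\<F> \<subseteq> V ` C" "C \<subseteq> \<Union>\<F>" by blast
  then obtain W where W: "W \<subseteq> C" "finite W" "\<F> = V ` W" by (meson finite_subset_image)
  have "u N \<in> C" for N
    unfolding C_def using closure_of_subset[of "range u" "free_lc_topology X"] uL by auto
  \<comment> \<open>Finitely many neighbourhoods cover the closure, yet each contains
    \<open>u N\<close> for only finitely many indices N.\<close>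
  then have "UNIV = (\<Union>w\<in>W. {N. u N \<in> V w})" using \<F>(3) W(3) by blast
  moreover have "finite (\<Union>w\<in>W. {N. u N \<in> V w})" using W CL V(3) by blast
  ultimately show False using infinite_UNIV_nat by simp
qed

theorem theoremt:
  fixes X :: "'a topology" and p :: ereal
  assumes "1 \<le> p"
    and "completely_regular_space X" and "Hausdorff_space X"
  shows "(\<forall>A. lc_bounded X A \<longrightarrow> coarse_p_limited p X A) \<and>
         (coarse_GP p X \<longleftrightarrow> (\<forall>A. functionally_bounded X A \<longrightarrow> finite A))"
  using weakly_bounded_imp_coarse_p_limited[OF assms lc_bounded_imp_weakly_bounded]
    coarse_GP_if_functionally_bounded_finite[OF assms]
    functionally_bounded_finite_if_coarse_GP[OF assms]
  by blast

end
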